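(* There exists an original support gap $\theta^\star$ such that $$C_{k,\theta^\star}^{\mathrm{line}}=C_k^{\circ}\qquad\text{for every }k=0,\dots,K,$$ and the greedy construction (with free-gap representatives, described in the context) produces such a gap.
   Context: Fix $L>0$, $w>0$ and integers $n,m\ge 1$. The circle is $\mathbb{S}^1_L=\mathbb{R}/L\mathbb{Z}$ with geodesic distance $d(x,y)=\min\{|x-y|,\,L-|x-y|\}$ for coordinates in $[0,L)$; clockwise means in the direction of increasing coordinate. Let $x_1,\dots,x_n$ (source atoms) and $y_1,\dots,y_m$ (target atoms) be pairwise distinct points of the circle, each of mass $w$; $N=n+m$, $K=\min(n,m)$. A matching $M$ is a set of pairs $(x_i,y_j)$ in which no atom appears twice; $C_k^\circ$ is the minimum of $w\sum_{(x_i,y_j)\in M}d(x_i,y_j)$ over matchings with $|M|=k$. Let $z_1,\dots,z_N$ be all atoms in clockwise cyclic order, $z_{N+1}=z_1$; the original support gaps are the $N$ open clockwise arcs from $z_i$ to $z_{i+1}$. Line costs. For a gap $G$, choose a point $\theta\in G$, cut the circle at $\theta$ and give each atom $z$ the unwrapped coordinate $t(z)=(z-\theta)\bmod L\in(0,L)$. $C_{k,G}^{\mathrm{line}}$ is the minimum of $w\sum_{(x_i,y_j)\in M}|t(x_i)-t(y_j)|$ over matchings with $|M|=k$ (it does not depend on $\theta\in G$). Cells. Given an active set $A$ of atoms, let $u_1,\dots,u_r$ ($r\ge1$) be the inactive atoms (those not in $A$) in clockwise cyclic order, $u_{r+1}=u_1$. The current cells are the $r$ closed clockwise arcs from $u_i$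 to $u_{i+1}$ (for $r=2$ the two complementary arcs; for $r=1$ the whole circle traversed once from $u_1$ to itself). A current cell is a candidate if its endpoints are of opposite type. For a finite set $P$ of points on a line with $j$ sources $x_{(1)}<\dots<x_{(j)}$ and $j$ targets $y_{(1)}<\dots<y_{(j)}$ put $c_{\mathbb R}(P)=w\sum_{i}|x_{(i)}-y_{(i)}|$. For a candidate cell $\mathcal C$ from $u$ clockwise to $v$, place its atoms on the line at their clockwise distance from $u$, let $\mathcal C^\circ$ be the atoms in the open arc, and set $\mathfrak m(\mathcal C)=c_{\mathbb R}(\mathcal C^\circ\cup\{u,v\})-c_{\mathbb R}(\mathcal C^\circ)$ (during the construction below interiors always contain equally many sources and targets). Greedy construction. Start with $A_0=\varnothing$; each initial cell stores its unique original gap as its representative. For $k=0,\dots,K-1$: select a candidate cell $[u,v]$ of minimum $\mathfrak m$ with respect to $A_k$ (ties broken arbitrarily) and set $A_{k+1}=A_k\cup\{u,v\}$. If $u,v$ were not the only inactive atoms, let $p$ be the inactive atom preceding $u$ and $q$ the inactive atom following $v$ (possibly $p=q$); the cells $[p,u],[u,v],[v,q]$ merge into $[p,q]$, which stores as representative that of $[p,u]$ or that of $[v,q]$. If $u,v$ were the only inactive atoms (which happens at the last step exactly when $n=m$), output as $\theta^\star$ the representative of the complementary cell from $v$ clockwise to $u$. If $n\ne m$, after step $K$ output as $\theta^\star$ the representative of any remaining current cell. *)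

theory Defs
  imports "HOL-Analysis.Analysis" "HOL-Library.Real_Mod"
begin

text \<open>
  The circle of length \<open>L\<close> is represented by its coordinates in \<open>{0..<L}\<close>; clockwise means
  increasing coordinate. The atoms are two disjoint finite sets of coordinates, the sources \<open>X\<close>
  and the targets \<open>Y\<close>, and every atom has mass \<open>w\<close>.
\<close>

definition circle_dist :: "real \<Rightarrow> real \<Rightarrow> real \<Rightarrow> real" where
  "circle_dist L a b = min \<bar>a - b\<bar> (L - \<bar>a - b\<bar>)"

definition clockwise :: "real \<Rightarrow> real \<Rightarrow> real \<Rightarrow> real" where
  "clockwise L a b = (b - a) rmod L"

text \<open>For \<open>u = v\<close> the open arc is the whole circle without \<open>u\<close>.\<close>

definition open_arc :: "real \<Rightarrow> real \<Rightarrow> real \<Rightarrow> real set" where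
  "open_arc L u v =
     {p \<in> {0..<L}. 0 < clockwise L u p \<and> (u = v \<or> clockwise L u p < clockwise L u v)}"

text \<open>
  The pairs of clockwise neighbours \<open>(u\<^sub>i, u\<^sub>i\<^sub>+\<^sub>1)\<close> of a finite set of points, including the pair
  that closes the cycle; a singleton \<open>{u}\<close> gives \<open>(u, u)\<close>.
\<close>

definition cyclic_pairs :: "real set \<Rightarrow> (real \<times> real) set" where
  "cyclic_pairs U =
     (let us = sorted_list_of_set U
      in {(us ! i, us ! (Suc i mod length us)) | i. i < length us})"

definition gaps :: "real \<Rightarrow> real set \<Rightarrow> real set set" where
  "gaps L Z = {open_arc L u v | u v. (u, v) \<in> cyclic_pairs Z}"


definition matchings :: "'a set \<Rightarrow> 'b set \<Rightarrow> nat \<Rightarrow> ('a \<times> 'b) set set" where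
  "matchings X Y k = {M. M \<subseteq> X \<times> Y \<and> inj_on fst M \<and> inj_on snd M \<and> card M = k}"

text \<open>Only meaningful for \<open>k \<le> min (card X) (card Y)\<close>; otherwise the minimum is over the empty set.\<close>

definition matching_cost ::
    "real \<Rightarrow> (real \<Rightarrow> real \<Rightarrow> real) \<Rightarrow> real set \<Rightarrow> real set \<Rightarrow> nat \<Rightarrow> real" where
  "matching_cost w c X Y k = Min ((\<lambda>M. w * (\<Sum>(a, b)\<in>M. c a b)) ` matchings X Y k)"

definition circle_cost :: "real \<Rightarrow> real \<Rightarrow> real set \<Rightarrow> real set \<Rightarrow> nat \<Rightarrow> real" where
  "circle_cost L w X Y k = matching_cost w (circle_dist L) X Y k"

definition cut_cost :: "real \<Rightarrow> real \<Rightarrow> real set \<Rightarrow> real set \<Rightarrow> real \<Rightarrow> nat \<Rightarrow> real" where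
  "cut_cost L w X Y \<theta> k =
     matching_cost w (\<lambda>a b. \<bar>(a - \<theta>) rmod L - (b - \<theta>) rmod L\<bar>) X Y k"

text \<open>The choice of the cut point in the gap is immaterial, see \<open>line_cost_eq\<close> below.\<close>

definition line_cost :: "real \<Rightarrow> real \<Rightarrow> real set \<Rightarrow> real set \<Rightarrow> real set \<Rightarrow> nat \<Rightarrow> real" where
  "line_cost L w X Y G k = cut_cost L w X Y (SOME \<theta>. \<theta> \<in> G) k"


text \<open>A cell is represented by its endpoints \<open>(u, v)\<close>: it is the closed clockwise arc from \<open>u\<close> to \<open>v\<close>.\<close>

definition cells :: "real set \<Rightarrow> real set \<Rightarrow> real set \<Rightarrow> (real \<times> real) set" where
  "cells X Y A = cyclic_pairs ((X \<union> Y) - A)"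

definition candidates :: "real set \<Rightarrow> real set \<Rightarrow> real set \<Rightarrow> (real \<times> real) set" where
  "candidates X Y A =
     {(u, v) \<in> cells X Y A. u \<in> X \<and> v \<in> Y \<or> u \<in> Y \<and> v \<in> X}"

text \<open>
  \<open>S\<close> and \<open>T\<close> are the source and target positions on the line; used for \<open>card S = card T\<close>.
\<close>

definition sorted_cost :: "real \<Rightarrow> real set \<Rightarrow> real set \<Rightarrow> real" where
  "sorted_cost w S T =
     w * (\<Sum>i<card S. \<bar>sorted_list_of_set S ! i - sorted_list_of_set T ! i\<bar>)"

definition marginal :: "real \<Rightarrow> real \<Rightarrow> real set \<Rightarrow> real set \<Rightarrow> real \<Rightarrow> real \<Rightarrow> real" where
  "marginal L w X Y u v =
     (let t = clockwise L u;
          I = open_arc L u v;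
          C = I \<union> {u, v}
      in sorted_cost w (t ` (X \<inter> C)) (t ` (Y \<inter> C)) - sorted_cost w (t ` (X \<inter> I)) (t ` (Y \<inter> I)))"

definition greedy_choice ::
    "real \<Rightarrow> real \<Rightarrow> real set \<Rightarrow> real set \<Rightarrow> real set \<Rightarrow> real \<Rightarrow> real \<Rightarrow> bool" where
  "greedy_choice L w X Y A u v \<longleftrightarrow>
     (u, v) \<in> candidates X Y A \<and>
     (\<forall>(u', v') \<in> candidates X Y A. marginal L w X Y u v \<le> marginal L w X Y u' v')"

text \<open>
  \<open>greedy_state L w X Y k A \<rho>\<close>: some run of the construction has, after \<open>k\<close> steps, active set \<open>A\<close>
  and representative gap \<open>\<rho> (u, v)\<close> stored in each current cell \<open>(u, v)\<close>. The values of \<open>\<rho>\<close> at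
  pairs that are not current cells are irrelevant. A step that uses up the last two inactive atoms
  leaves no cell and leads directly to an output (rule \<open>closing\<close> of \<open>greedy_output\<close>).
\<close>

inductive greedy_state ::
    "real \<Rightarrow> real \<Rightarrow> real set \<Rightarrow> real set \<Rightarrow> nat \<Rightarrow> real set \<Rightarrow> (real \<times> real \<Rightarrow> real set) \<Rightarrow> bool"
  for L w X Y where
  start: "greedy_state L w X Y 0 {} (\<lambda>(u, v). open_arc L u v)"
| merge: "greedy_state L w X Y (Suc k) (A \<union> {u, v}) (\<rho>((p, q) := G))"
    if "greedy_state L w X Y k A \<rho>" and "k < min (card X) (card Y)"
      and "greedy_choice L w X Y A u v"
      and "(X \<union> Y) - A \<noteq> {u, v}"
      and "(p, u) \<in> cells X Y A" and "(v, q) \<in> cells X Y A"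
      and "G = \<rho> (p, u) \<or> G = \<rho> (v, q)"

inductive greedy_output ::
    "real \<Rightarrow> real \<Rightarrow> real set \<Rightarrow> real set \<Rightarrow> real set \<Rightarrow> bool"
  for L w X Y where
  closing: "greedy_output L w X Y (\<rho> (v, u))"
    if "greedy_state L w X Y k A \<rho>" and "k < min (card X) (card Y)"
      and "greedy_choice L w X Y A u v"
      and "(X \<union> Y) - A = {u, v}"
| remaining: "greedy_output L w X Y (\<rho> (u, v))"
    if "card X \<noteq> card Y"
      and "greedy_state L w X Y (min (card X) (card Y)) A \<rho>"
      and "(u, v) \<in> cells X Y A"


lemma clockwise_eq:
  assumes "a \<in> {0..<L}" "b \<in> {0..<L}"
  shows "clockwise L a b = (if a \<le> b then b - a else b - a + L)"
  unfolding clockwise_def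
proof (rule rmod_unique)
  show "b - a = (if a \<le> b then b - a else b - a + L) + of_int (if a \<le> b then 0 else -1) * L"
    by simp
qed (use assms in auto)

lemma cyclic_pairs_mem:
  assumes "finite Z" "(u, v) \<in> cyclic_pairs Z"
  shows "u \<in> Z" "v \<in> Z"
proof -
  let ?us = "sorted_list_of_set Z"
  obtain i where i: "i < length ?us" "u = ?us ! i" "v = ?us ! (Suc i mod length ?us)"
    using assms(2) by (auto simp: cyclic_pairs_def Let_def)
  then have "Suc i mod length ?us < length ?us"
    by (intro mod_less_divisor) linarith
  then show "u \<in> Z" "v \<in> Z"
    using i assms(1) by (metis nth_mem set_sorted_list_of_set)+
qed

lemma cyclic_pairs_no_between:
  assumes "finite Z" "Z \<subseteq> {0..<L}" "(u, v) \<in> cyclic_pairs Z"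
  shows "open_arc L u v \<inter> Z = {}"
proof -
  let ?us = "sorted_list_of_set Z"
  have uv: "u \<in> {0..<L}" "v \<in> {0..<L}"
    using cyclic_pairs_mem[OF assms(1,3)] assms(2) by auto
  obtain i where i: "i < length ?us" "u = ?us ! i" "v = ?us ! (Suc i mod length ?us)"
    using assms(3) by (auto simp: cyclic_pairs_def Let_def)
  have mono: "?us ! a \<le> ?us ! b" if "a \<le> b" "b < length ?us" for a b
    using that by (simp add: sorted_nth_mono)
  have "z \<notin> open_arc L u v" if z: "z \<in> Z" for z
  proof -
    obtain j where j: "j < length ?us" "z = ?us ! j"
      using z assms(1) by (metis in_set_conv_nth set_sorted_list_of_set)
    have zL: "z \<in> {0..<L}"
      using z assms(2) by auto
    show ?thesis
    proof (cases "Suc i < length ?us")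
      case True
      then have v: "v = ?us ! Suc i" using i by simp
      have "u < v"
        using sorted_wrt_nth_less[OF strict_sorted_list_of_set[of Z] lessI True] v i(2) by simp
      moreover have "z \<le> u \<or> v \<le> z"
        using mono[of j i] mono[of "Suc i" j] True i j v by (cases "j \<le> i") auto
      ultimately show ?thesis
        using zL uv by (auto simp: open_arc_def clockwise_eq)
    next
      case False
      then have "Suc i = length ?us" using i by simp
      then have "v = ?us ! 0" "j \<le> i" using i j by auto
      then have "v \<le> z" "z \<le> u"
        using mono[of 0 j] mono[of j i] i j by auto
      then show ?thesis
        using zL uv by (auto simp: open_arc_def clockwise_eq)
    qed
  qed
  then show ?thesis by blast
qed

lemma open_arc_nonempty:
  assumes "u \<in> {0..<L}" "v \<in> {0..<L}"
  shows "open_arc L u v \<noteq> {}"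
proof -
  define d where "d = (if u = v then L else clockwise L u v)"
  have d: "0 < d" "d \<le> L"
    using assms by (auto simp: d_def clockwise_eq)
  define p where "p = (if u + d / 2 < L then u + d / 2 else u + d / 2 - L)"
  have p: "p \<in> {0..<L}" "clockwise L u p = d / 2"
    using assms d by (auto simp: p_def clockwise_eq)
  then have "p \<in> open_arc L u v"
    using d by (auto simp: open_arc_def d_def split: if_splits)
  then show ?thesis by blast
qed

lemma cut_cost_indep:
  assumes "finite X" "finite Y" "X \<union> Y \<subseteq> {0..<L}"
    and "G \<in> gaps L (X \<union> Y)" "\<theta> \<in> G" "\<theta>' \<in> G"
  shows "cut_cost L w X Y \<theta> k = cut_cost L w X Y \<theta>' k"
proof -
  obtain u v where G: "G = open_arc L u v" and uv: "(u, v) \<in> cyclic_pairs (X \<union> Y)"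
    using assms(4) by (auto simp: gaps_def)
  have u: "u \<in> {0..<L}"
    using cyclic_pairs_mem[OF _ uv] assms(1-3) by auto
  have none: "z \<notin> open_arc L u v" if "z \<in> X \<union> Y" for z
    using cyclic_pairs_no_between[OF _ assms(3) uv] assms(1,2) that by auto
  define s where "s z = (if z = u then L else clockwise L u z)" for z
  have shift: "(z - t) rmod L = s z - clockwise L u t"
    if z: "z \<in> X \<union> Y" and t: "t \<in> open_arc L u v" for z t
  proof -
    have zL: "z \<in> {0..<L}" and tL: "t \<in> {0..<L}"
      using z t assms(3) by (auto simp: open_arc_def)
    have "clockwise L u t < s z"
      using none[OF z] t zL tL u
      by (auto simp: open_arc_def s_def clockwise_eq split: if_splits)
    moreover have "t \<noteq> u"
      using t u by (auto simp: open_arc_def clockwise_eq)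
    ultimately show ?thesis
      using zL tL u clockwise_eq[OF tL zL]
      by (auto simp: clockwise_def[of L t] s_def clockwise_eq split: if_splits)
  qed
  have "(\<Sum>(a, b)\<in>M. \<bar>(a - \<theta>) rmod L - (b - \<theta>) rmod L\<bar>) =
        (\<Sum>(a, b)\<in>M. \<bar>(a - \<theta>') rmod L - (b - \<theta>') rmod L\<bar>)" if "M \<in> matchings X Y k" for M
    using that assms(5,6) G by (intro sum.cong) (auto simp: matchings_def shift subset_iff)
  then show ?thesis
    unfolding cut_cost_def matching_cost_def
    by (intro arg_cong[of _ _ Min] image_cong refl arg_cong2[of _ _ _ _ "(*)"])
qed

lemma line_cost_eq:
  assumes "finite X" "finite Y" "X \<union> Y \<subseteq> {0..<L}" "G \<in> gaps L (X \<union> Y)" "\<theta> \<in> G"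
  shows "line_cost L w X Y G k = cut_cost L w X Y \<theta> k"
  unfolding line_cost_def using assms by (intro cut_cost_indep) (auto intro: someI)

lemma gaps_nonempty:
  assumes "finite Z" "Z \<subseteq> {0..<L}" "G \<in> gaps L Z"
  shows "G \<noteq> {}"
proof -
  obtain u v where G: "G = open_arc L u v" and uv: "(u, v) \<in> cyclic_pairs Z"
    using assms(3) by (auto simp: gaps_def)
  have "u \<in> {0..<L}" "v \<in> {0..<L}"
    using cyclic_pairs_mem[OF assms(1) uv] assms(2) by auto
  then show ?thesis
    unfolding G by (rule open_arc_nonempty)
qed

end

theory Submission
  imports Defs
begin

text \<open>
  Every stage of the greedy construction carries a primal-dual certificate. The active set \<open>A\<close>
  determines an integer flow \<open>f\<close> on the gaps, with one unit leaving each active source and entering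
  each active target, and no flow next to an inactive atom. A potential \<open>\<phi>\<close> on the atoms changes by
  at most the gap length along each gap, by exactly that length in the direction of nonzero flow, and
  separates the atoms: inactive sources have \<open>\<phi> = 0\<close>, active ones \<open>\<phi> \<ge> 0\<close>, inactive targets
  \<open>\<phi> = \<beta>\<close>, active ones \<open>\<phi> \<le> \<beta>\<close>. Summation by parts turns the flow cost into a potential
  difference, which is a lower bound for every circle matching with as many pairs; if a gap carries no
  flow, cutting there realises the flow on the line.

  A greedy step is a shortest augmenting path: paths between inactive atoms of equal type have
  nonnegative residual cost, so the cheapest source-target path crosses a single candidate cell,
  and its residual cost is the marginal. Shortest residual distances give the next potential, and
  the flow changes only inside the selected cell, which is never the cell of a kept representative.
\<close>

subsection \<open>Sorted matching on the line as a flow\<close>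

lemma sorted_list_of_set_image_strict_mono:
  fixes p :: "'a::linorder \<Rightarrow> 'b::linorder"
  assumes "strict_mono p" "finite S"
  shows "sorted_list_of_set (p ` S) = map p (sorted_list_of_set S)"
proof -
  have "sorted (map p (sorted_list_of_set S))"
    using assms(1) by (simp add: sorted_map strict_mono_less_eq)
  moreover have "distinct (map p (sorted_list_of_set S))"
    using assms(1) by (auto simp: distinct_map strict_mono_imp_inj_on intro: inj_on_subset)
  ultimately have "sorted_list_of_set (set (map p (sorted_list_of_set S))) = map p (sorted_list_of_set S)"
    by (rule sorted_list_of_set.idem_if_sorted_distinct)
  then show ?thesis
    using assms(2) by simp
qed

text \<open>The indices whose entry is at most \<open>r\<close> form an initial segment of the
  sorted list, so comparing an order statistic with \<open>r\<close> reduces to a count.\<close>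

lemma nth_sorted_list_of_set_le_iff:
  fixes S :: "'a::linorder set"
  assumes "finite S" "i < card S"
  shows "sorted_list_of_set S ! i \<le> r \<longleftrightarrow> i < card {s \<in> S. s \<le> r}"
proof -
  define us where "us = sorted_list_of_set S"
  define J where "J = {j. j < length us \<and> us ! j \<le> r}"
  have len: "length us = card S" and dist: "distinct us" and set: "set us = S"
    and srt: "sorted us"
    using assms by (auto simp: us_def)
  have "(!) us ` J = {s \<in> S. s \<le> r}"
    unfolding J_def using set by (auto simp: in_set_conv_nth)
  moreover have "inj_on ((!) us) J"
    using dist by (auto simp: inj_on_def J_def nth_eq_iff_index_eq)
  ultimately have card_J: "card J = card {s \<in> S. s \<le> r}"
    by (metis card_image)
  have "finite J" by (simp add: J_def)
  show ?thesis
  proof (cases "us ! i \<le> r")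
    case True
    have "{..i} \<subseteq> J"
      using True assms(2) srt len by (fastforce simp: J_def intro: order_trans[OF sorted_nth_mono])
    then have "card {..i} \<le> card J"
      using \<open>finite J\<close> by (rule card_mono[rotated])
    then show ?thesis using True card_J us_def by simp
  next
    case False
    have "J \<subseteq> {..<i}"
    proof
      fix j assume "j \<in> J"
      then have "us ! j \<le> r" "j < length us" by (auto simp: J_def)
      then show "j \<in> {..<i}"
        using False srt by (metis lessThan_iff linorder_not_le order_trans sorted_nth_mono)
    qed
    then have "card J \<le> i"
      using card_mono[of "{..<i}" J] by simp
    then show ?thesis using False card_J us_def by simp
  qed
qed

lemma sum_abs_diff_initial_segments:
  fixes c d n :: nat
  assumes "c \<le> n" "d \<le> n"
  shows "(\<Sum>i<n. \<bar>of_bool (i < c) - of_bool (i < d)\<bar> :: real) = \<bar>real c - real d\<bar>"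
proof -
  have *: "(\<Sum>i<n. \<bar>of_bool (i < c) - of_bool (i < d)\<bar> :: real) = real d - real c"
    if "c \<le> d" "d \<le> n" for c d :: nat
  proof -
    have "(\<Sum>i<n. \<bar>of_bool (i < c) - of_bool (i < d)\<bar> :: real) = (\<Sum>i<n. of_bool (i \<in> {c..<d}))"
      using that by (intro sum.cong) auto
    also have "\<dots> = real (card ({..<n} \<inter> {c..<d}))"
      by (subst sum_of_bool_eq) (auto simp: Int_def)
    also have "{..<n} \<inter> {c..<d} = {c..<d}"
      using that by auto
    finally show ?thesis using that by simp
  qed
  show ?thesis
    using *[of c d] *[of d c] assms
    by (cases "c \<le> d") (auto simp: abs_minus_commute)
qed

lemma sum_int_telescope:
  fixes p :: "int \<Rightarrow> 'a::ab_group_add"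
  assumes "a \<le> b"
  shows "(\<Sum>t\<in>{a..<b}. p (t + 1) - p t) = p b - p a"
  using assms
proof (induction b rule: int_ge_induct)
  case (step b)
  then have "{a..<b + 1} = insert b {a..<b}" by auto
  then show ?case using step by simp
qed simp

text \<open>The steps from \<open>r\<close> to \<open>r + 1\<close> that separate \<open>s\<close>
  from \<open>t\<close> tile the interval between their positions. The indicator form allows
  swapping this sum with a sum over matched pairs.\<close>

lemma abs_diff_eq_sum_crossings:
  fixes p :: "int \<Rightarrow> real"
  assumes "strict_mono p" "s \<in> {a..b}" "t \<in> {a..b}"
  shows "\<bar>p s - p t\<bar> = (\<Sum>r\<in>{a..<b}. (p (r + 1) - p r) * \<bar>of_bool (s \<le> r) - of_bool (t \<le> r)\<bar>)"
proof -
  have *: "\<bar>p s - p t\<bar> = (\<Sum>r\<in>{a..<b}. (p (r + 1) - p r) * \<bar>of_bool (s \<le> r) - of_bool (t \<le> r)\<bar>)"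
    if "s \<le> t" "s \<in> {a..b}" "t \<in> {a..b}" for s t
  proof -
    have "(\<Sum>r\<in>{a..<b}. (p (r + 1) - p r) * \<bar>of_bool (s \<le> r) - of_bool (t \<le> r)\<bar>)
        = (\<Sum>r\<in>{s..<t}. p (r + 1) - p r)"
      using that by (intro sum.mono_neutral_cong_right) auto
    also have "\<dots> = p t - p s"
      using that by (intro sum_int_telescope)
    also have "\<dots> = \<bar>p s - p t\<bar>"
      using that assms(1) by (simp add: strict_mono_less_eq)
    finally show ?thesis ..
  qed
  show ?thesis
  proof (cases "s \<le> t")
    case False
    then have "\<bar>p t - p s\<bar> = (\<Sum>r\<in>{a..<b}. (p (r + 1) - p r) * \<bar>of_bool (t \<le> r) - of_bool (s \<le> r)\<bar>)"
      using assms by (intro *) auto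
    then show ?thesis
      by (simp add: abs_minus_commute)
  qed (use * assms in auto)
qed

text \<open>Swapping the sums over pairs and over steps counts, for each step \<open>r\<close>, the
  sorted pairs that straddle it: those whose index \<open>i\<close> lies between the two counts of
  points up to \<open>r\<close>. Their number is the absolute net flow forced across the
  step.\<close>

lemma sorted_cost_eq_flow_cost:
  fixes p :: "int \<Rightarrow> real"
  assumes "strict_mono p" "S \<subseteq> {a..b}" "T \<subseteq> {a..b}" "card S = card T"
  shows "sorted_cost w (p ` S) (p ` T) =
         w * (\<Sum>r\<in>{a..<b}. (p (r + 1) - p r) *
                 \<bar>real (card {s \<in> S. s \<le> r}) - real (card {s \<in> T. s \<le> r})\<bar>)"
proof -
  have fin: "finite S" "finite T"
    using assms by (auto intro: finite_subset)
  define n where "n = card S"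
  let ?S = "sorted_list_of_set S" and ?T = "sorted_list_of_set T"
  have mem: "?S ! i \<in> {a..b}" "?T ! i \<in> {a..b}" if "i < n" for i
    using that assms fin unfolding n_def
    by (metis nth_mem set_sorted_list_of_set length_sorted_list_of_set subsetD)+
  have crd: "card (p ` S) = n"
    unfolding n_def using assms(1) by (intro card_image strict_mono_imp_inj_on[THEN inj_on_subset]) auto
  have cS: "?S ! i \<le> r \<longleftrightarrow> i < card {s \<in> S. s \<le> r}"
    and cT: "?T ! i \<le> r \<longleftrightarrow> i < card {s \<in> T. s \<le> r}" if "i < n" for i r
    using that assms(4) fin by (auto simp: n_def nth_sorted_list_of_set_le_iff)
  have le: "card {s \<in> S. s \<le> r} \<le> n" "card {s \<in> T. s \<le> r} \<le> n" for r
    using fin assms(4) card_mono[of S "{s \<in> S. s \<le> r}"] card_mono[of T "{s \<in> T. s \<le> r}"]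
    by (auto simp: n_def)
  have "sorted_cost w (p ` S) (p ` T) = w * (\<Sum>i<n. \<bar>p (?S ! i) - p (?T ! i)\<bar>)"
    unfolding sorted_cost_def crd using assms(1,4) fin n_def
    by (simp add: sorted_list_of_set_image_strict_mono)
  also have "(\<Sum>i<n. \<bar>p (?S ! i) - p (?T ! i)\<bar>) =
      (\<Sum>i<n. \<Sum>r\<in>{a..<b}. (p (r + 1) - p r) * \<bar>of_bool (?S ! i \<le> r) - of_bool (?T ! i \<le> r)\<bar>)"
    using mem by (intro sum.cong abs_diff_eq_sum_crossings assms(1)) auto
  also have "\<dots> = (\<Sum>r\<in>{a..<b}. (p (r + 1) - p r) *
      (\<Sum>i<n. \<bar>of_bool (i < card {s \<in> S. s \<le> r}) - of_bool (i < card {s \<in> T. s \<le> r})\<bar>))"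
    by (subst sum.swap) (simp add: cS cT sum_distrib_left)
  also have "\<dots> = (\<Sum>r\<in>{a..<b}. (p (r + 1) - p r) *
      \<bar>real (card {s \<in> S. s \<le> r}) - real (card {s \<in> T. s \<le> r})\<bar>)"
    using le by (subst sum_abs_diff_initial_segments[of _ n]) auto
  finally show ?thesis .
qed

subsection \<open>Cyclic order\<close>

lemma clockwise_inject:
  assumes "u \<in> {0..<L}" "a \<in> {0..<L}" "b \<in> {0..<L}" "clockwise L u a = clockwise L u b"
  shows "a = b"
  using assms(4) unfolding clockwise_eq[OF assms(1,2)] clockwise_eq[OF assms(1,3)]
  using assms(1-3) by (auto split: if_splits)

lemma cyclic_pairs_iff:
  assumes "finite U" "U \<subseteq> {0..<L}"
  shows "(u, v) \<in> cyclic_pairs U \<longleftrightarrow> u \<in> U \<and> v \<in> U \<and> open_arc L u v \<inter> U = {}"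
proof
  assume "(u, v) \<in> cyclic_pairs U"
  then show "u \<in> U \<and> v \<in> U \<and> open_arc L u v \<inter> U = {}"
    using cyclic_pairs_mem[OF assms(1)] cyclic_pairs_no_between[OF assms] by blast
next
  assume uv: "u \<in> U \<and> v \<in> U \<and> open_arc L u v \<inter> U = {}"
  obtain v' where v': "(u, v') \<in> cyclic_pairs U"
  proof -
    have "u \<in> set (sorted_list_of_set U)" using uv assms(1) by simp
    then obtain i where i: "i < length (sorted_list_of_set U)" "sorted_list_of_set U ! i = u"
      unfolding in_set_conv_nth by blast
    show ?thesis
      by (rule that[of "sorted_list_of_set U ! (Suc i mod length (sorted_list_of_set U))"])
        (use i in \<open>auto simp: cyclic_pairs_def Let_def\<close>)
  qed
  have "v' \<in> U" and free: "open_arc L u v' \<inter> U = {}"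
    using cyclic_pairs_mem[OF assms(1) v'] cyclic_pairs_no_between[OF assms v'] by auto
  have rng: "u \<in> {0..<L}" "v \<in> {0..<L}" "v' \<in> {0..<L}"
    using uv \<open>v' \<in> U\<close> assms(2) by auto
  have pos: "0 < clockwise L u a" if "a \<in> {0..<L}" "a \<noteq> u" for a
    using that rng(1) by (auto simp: clockwise_eq)
  \<comment> \<open>If one of the two endpoints is \<open>u\<close>, its arc is the whole circle
    without \<open>u\<close>, which forces the other to be \<open>u\<close> as well; otherwise their
    clockwise distances from \<open>u\<close> agree.\<close>
  have "v \<notin> open_arc L u v'" "v' \<notin> open_arc L u v"
    using uv \<open>v' \<in> U\<close> free by auto
  then have "v = v'"
    using rng pos[of v] pos[of v'] clockwise_inject[OF rng]
    by (force simp: open_arc_def)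
  then show "(u, v) \<in> cyclic_pairs U" using v' by simp
qed

section \<open>Periodic indexing of the atoms\<close>

locale circle_atoms =
  fixes L w :: real and X Y :: "real set"
  assumes L_pos: "L > 0" and w_pos: "w > 0"
    and fin_X: "finite X" and fin_Y: "finite Y"
    and range: "X \<union> Y \<subseteq> {0..<L}" and disjoint: "X \<inter> Y = {}"
    and X_ne: "X \<noteq> {}" and Y_ne: "Y \<noteq> {}"
begin

text \<open>The atoms \<open>z i\<close> are indexed periodically by the integers; \<open>P i\<close> is the position of \<open>z i\<close> on
  the universal cover of the circle.\<close>

definition N :: int where "N = int (card (X \<union> Y))"

definition z :: "int \<Rightarrow> real" where "z i = sorted_list_of_set (X \<union> Y) ! nat (i mod N)"

definition P :: "int \<Rightarrow> real" where "P i = z i + L * of_int (i div N)"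

definition \<sigma> :: "int \<Rightarrow> int" where "\<sigma> i = (if z i \<in> X then 1 else -1)"

definition gap :: "int \<Rightarrow> real set" where "gap i = open_arc L (z i) (z (i + 1))"

lemma N_ge_2: "N \<ge> 2"
proof -
  obtain a b where ab: "a \<in> X" "b \<in> Y" using X_ne Y_ne by auto
  then have "a \<noteq> b" using disjoint by auto
  then have "card {a, b} = 2" by simp
  moreover have "card {a, b} \<le> card (X \<union> Y)"
    using ab fin_X fin_Y by (intro card_mono) auto
  ultimately show ?thesis by (simp add: N_def)
qed

lemma mod_N_bounds: "0 \<le> i mod N" "i mod N < N"
  using N_ge_2 by simp_all

lemma nat_mod_N_less: "nat (i mod N) < card (X \<union> Y)"
proof -
  have "int (nat (i mod N)) < N" using mod_N_bounds[of i] by simp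
  then show ?thesis unfolding N_def by linarith
qed

lemma z_mem: "z i \<in> X \<union> Y"
  using nat_mod_N_less[of i] fin_X fin_Y unfolding z_def
  by (metis finite_UnI length_sorted_list_of_set nth_mem set_sorted_list_of_set)

lemma z_range: "0 \<le> z i" "z i < L"
  using z_mem[of i] range by auto

lemma z_notin_X_iff: "z i \<notin> X \<longleftrightarrow> z i \<in> Y"
  using z_mem[of i] disjoint by auto

lemma z_add_mult: "z (i + k * N) = z i"
  by (simp add: z_def)

lemma z_add_N: "z (i + N) = z i" "z (i - N) = z i"
  using z_add_mult[of i 1] z_add_mult[of i "-1"] by auto

lemma z_eq_iff: "z i = z j \<longleftrightarrow> i mod N = j mod N"
proof -
  have "z i = z j \<longleftrightarrow> nat (i mod N) = nat (j mod N)"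
    unfolding z_def using nat_mod_N_less[of i] nat_mod_N_less[of j] fin_X fin_Y
    by (subst nth_eq_iff_index_eq) auto
  then show ?thesis
    using mod_N_bounds by (simp add: eq_nat_nat_iff)
qed

lemma z_eqE:
  assumes "z i = z j"
  obtains k where "i = j + k * N"
proof
  show "i = j + (i div N - j div N) * N"
    using assms[unfolded z_eq_iff] div_mult_mod_eq[of i N] div_mult_mod_eq[of j N]
    unfolding left_diff_distrib by linarith
qed

lemma z_surj:
  assumes "a \<in> X \<union> Y"
  obtains i where "g < i" "i \<le> g + N" "z i = a"
proof -
  have "a \<in> set (sorted_list_of_set (X \<union> Y))"
    using assms fin_X fin_Y by simp
  then obtain n where n: "n < card (X \<union> Y)" "sorted_list_of_set (X \<union> Y) ! n = a"
    by (auto simp: in_set_conv_nth)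
  \<comment> \<open>The first index after \<open>g\<close> that is congruent to \<open>n\<close>
    modulo \<open>N\<close>.\<close>
  define i where "i = g + 1 + (int n - (g + 1)) mod N"
  have "i mod N = int n mod N"
    unfolding i_def by (simp add: mod_add_right_eq)
  then have "z i = a"
    using n by (simp add: z_def N_def)
  moreover have "g < i" "i \<le> g + N"
    using mod_N_bounds[of "int n - (g + 1)"] unfolding i_def by linarith+
  ultimately show ?thesis using that by blast
qed

lemma z_inj_on_period: "inj_on z {g<..g + N}"
proof (rule inj_onI)
  fix i j assume ij: "i \<in> {g<..g + N}" "j \<in> {g<..g + N}" "z i = z j"
  obtain k where k: "i = j + k * N" using z_eqE[OF ij(3)] .
  with ij have "\<bar>k * N\<bar> < N" by auto
  then have "\<bar>k\<bar> * \<bar>N\<bar> < 1 * \<bar>N\<bar>" using N_ge_2 by (simp add: abs_mult)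
  then have "k = 0" using N_ge_2 by (subst (asm) mult_less_cancel_right) auto
  then show "i = j" using k by simp
qed

lemma z_image_period: "z ` {g<..g + N} = X \<union> Y"
proof
  show "z ` {g<..g + N} \<subseteq> X \<union> Y" using z_mem by auto
  show "X \<union> Y \<subseteq> z ` {g<..g + N}"
    using z_surj[of _ g] by (metis greaterThanAtMost_iff imageI subsetI)
qed

lemma P_add_mult: "P (i + k * N) = P i + L * of_int k"
proof -
  have "(i + k * N) div N = i div N + k" using N_ge_2 by simp
  then show ?thesis by (simp add: P_def z_add_mult algebra_simps)
qed

lemma P_add_N: "P (i + N) = P i + L"
  using P_add_mult[of i 1] by simp

lemma P_eq_on_base:
  assumes "0 \<le> i" "i < N"
  shows "P i = sorted_list_of_set (X \<union> Y) ! nat i"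
  using assms by (simp add: P_def z_def)

text \<open>Inside a period the order is that of the sorted list; at the wrap the next position is
  \<open>z 0 + L\<close>, beyond every coordinate. Periodicity carries the one-step inequality to
  all indices.\<close>

lemma P_strict_mono: "strict_mono P"
proof -
  have base: "P i < P (i + 1)" if "0 \<le> i" "i < N" for i
  proof (cases "i + 1 < N")
    case True
    then have "nat i < nat (i + 1)" "nat (i + 1) < card (X \<union> Y)"
      using that N_def by auto
    then show ?thesis
      using True that strict_sorted_list_of_set[of "X \<union> Y"]
      by (auto simp: P_eq_on_base sorted_wrt_iff_nth_less)
  next
    case False
    then have "i + 1 = N" using that by simp
    then have "P (i + 1) = z 0 + L" using N_ge_2 P_add_N[of 0] by (simp add: P_def)
    moreover have "P i = z i" using that by (simp add: P_def)
    ultimately show ?thesis using z_range[of i] z_range[of 0] by simp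
  qed
  have P_step: "P i < P (i + 1)" for i
  proof -
    have "P (i mod N) < P (i mod N + 1)"
      using mod_N_bounds by (intro base)
    then have "P (i mod N + i div N * N) < P (i mod N + 1 + i div N * N)"
      unfolding P_add_mult by simp
    moreover have "i mod N + 1 + i div N * N = i + 1" "i mod N + i div N * N = i"
      using div_mult_mod_eq[of i N] by linarith+
    ultimately show ?thesis by simp
  qed
  show ?thesis
  proof (rule strict_monoI)
    fix i j :: int assume "i < j"
    then show "P i < P j"
    proof (induction j rule: int_gr_induct)
      case base
      show ?case by (rule P_step)
    next
      case (step j)
      from step.IH P_step[of j] show ?case by (rule less_trans)
    qed
  qed
qed

lemma P_less_iff [simp]: "P i < P j \<longleftrightarrow> i < j"
  using P_strict_mono by (simp add: strict_mono_less)

lemma P_le_iff [simp]: "P i \<le> P j \<longleftrightarrow> i \<le> j"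
  using P_strict_mono by (simp add: strict_mono_less_eq)

lemma P_diff_periodic:
  assumes "z i = z j"
  shows "P (i + 1) - P i = P (j + 1) - P j"
proof -
  obtain k where k: "i = j + k * N" using z_eqE[OF assms] .
  have "P (i + 1) = P (j + 1) + L * of_int k"
    unfolding k using P_add_mult[of "j + 1" k] by (simp add: algebra_simps)
  then show ?thesis using k by (simp add: P_add_mult)
qed

lemma z_succ_periodic:
  assumes "z i = z j"
  shows "z (i + c) = z (j + c)"
  using assms unfolding z_eq_iff by (rule mod_add_cong) simp

text \<open>The difference on the cover lies between \<open>0\<close> and \<open>L\<close> and
  differs from that of the coordinates by whole turns, so it is the remainder.\<close>

lemma clockwise_z:
  assumes "i \<le> t" "t < i + N"
  shows "clockwise L (z i) (z t) = P t - P i"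
  unfolding clockwise_def
proof (rule rmod_unique)
  have "P t < P i + L" using assms(2) unfolding P_add_N[symmetric] by simp
  then show "P t - P i \<in> {0..<\<bar>L\<bar>}" using assms(1) L_pos by auto
  show "z t - z i = P t - P i + of_int (i div N - t div N) * L"
    unfolding P_def of_int_diff left_diff_distrib by (simp add: mult.commute)
qed

text \<open>The bound \<open>j \<le> i + N\<close> includes the full turn, where both endpoints are
  the same atom; this is the cell of a single inactive atom.\<close>

lemma open_arc_z:
  assumes "i < j" "j \<le> i + N"
  shows "open_arc L (z i) (z j) \<inter> (X \<union> Y) = z ` {i<..<j}"
proof -
  have iff: "z t \<in> open_arc L (z i) (z j) \<longleftrightarrow> t \<in> {i<..<j}" if t: "i \<le> t" "t < i + N" for t
  proof (cases "j = i + N")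
    case True
    then show ?thesis
      using t z_range[of t] by (auto simp: open_arc_def z_add_N clockwise_z)
  next
    case False
    then have "z i \<noteq> z j"
      using z_inj_on_period[of "i - 1"] assms by (auto dest: inj_onD)
    then show ?thesis
      using t False assms z_range[of t] by (auto simp: open_arc_def clockwise_z)
  qed
  show ?thesis
  proof (intro subset_antisym subsetI)
    fix a assume a: "a \<in> open_arc L (z i) (z j) \<inter> (X \<union> Y)"
    then obtain t where "i - 1 < t" "t \<le> i - 1 + N" "z t = a" using z_surj[of a "i - 1"] by auto
    then show "a \<in> z ` {i<..<j}" using iff[of t] a by auto
  next
    fix a assume "a \<in> z ` {i<..<j}"
    then show "a \<in> open_arc L (z i) (z j) \<inter> (X \<union> Y)" using iff assms z_mem by auto
  qed
qed

section \<open>Cells and gaps in terms of indices\<close>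

lemma fin_atoms: "finite (X \<union> Y)" using fin_X fin_Y by simp

text \<open>The right side bounds no length: an active interior cannot pass index
  \<open>i + N\<close>, which is the inactive atom \<open>z i\<close> again.\<close>

lemma cells_iff:
  "(a, b) \<in> cells X Y A \<longleftrightarrow>
   (\<exists>i j. i < j \<and> z i = a \<and> z j = b \<and> z i \<notin> A \<and> z j \<notin> A \<and> z ` {i<..<j} \<subseteq> A)"
proof -
  have iff: "(a, b) \<in> cells X Y A \<longleftrightarrow>
      a \<in> (X \<union> Y) - A \<and> b \<in> (X \<union> Y) - A \<and> open_arc L a b \<inter> (X \<union> Y) \<subseteq> A"
    unfolding cells_def using fin_atoms range by (subst cyclic_pairs_iff[of _ L]) auto
  show ?thesis
  proof
    assume "(a, b) \<in> cells X Y A"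
    then have ab: "a \<in> X \<union> Y" "b \<in> X \<union> Y" "a \<notin> A" "b \<notin> A" "open_arc L a b \<inter> (X \<union> Y) \<subseteq> A"
      unfolding iff by auto
    obtain i where i: "0 < i" "i \<le> 0 + N" "z i = a" using z_surj[OF ab(1)] .
    obtain j where j: "i < j" "j \<le> i + N" "z j = b" using z_surj[OF ab(2)] .
    show "\<exists>i j. i < j \<and> z i = a \<and> z j = b \<and> z i \<notin> A \<and> z j \<notin> A \<and> z ` {i<..<j} \<subseteq> A"
      using ab i j open_arc_z[OF j(1,2)] by auto
  next
    assume "\<exists>i j. i < j \<and> z i = a \<and> z j = b \<and> z i \<notin> A \<and> z j \<notin> A \<and> z ` {i<..<j} \<subseteq> A"
    then obtain i j where ij: "i < j" "z i = a" "z j = b" "z i \<notin> A" "z j \<notin> A" "z ` {i<..<j} \<subseteq> A"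
      by auto
    have "j \<le> i + N"
    proof (rule ccontr)
      assume "\<not> ?thesis"
      then have "i + N \<in> {i<..<j}" using N_ge_2 by auto
      then have "z (i + N) \<in> A" using ij(6) by blast
      then show False using ij(4) by (simp add: z_add_N)
    qed
    then show "(a, b) \<in> cells X Y A"
      unfolding iff using ij z_mem[of i] z_mem[of j] open_arc_z[of i j] by auto
  qed
qed

lemma cell_width:
  assumes "z i \<notin> A" "z ` {i<..<j} \<subseteq> A" "z i \<noteq> z j"
  shows "j < i + N"
proof (rule ccontr)
  assume "\<not> ?thesis"
  moreover have "z (i + N) \<noteq> z j" using assms(3) by (simp add: z_add_N)
  ultimately have "i + N \<in> {i<..<j}" using N_ge_2 by (cases "j = i + N") auto
  then have "z (i + N) \<in> A" using assms(2) by blast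
  then show False using assms(1) by (simp add: z_add_N)
qed

text \<open>Shifting by whole periods lets the starting index be prescribed;
  \<open>cells_at_end\<close> does the same for the end. Consecutive cells can then be glued on the
  cover.\<close>

lemma cells_at_start:
  assumes "(z i, b) \<in> cells X Y A"
  obtains j where "i < j" "z j = b" "z i \<notin> A" "z j \<notin> A" "z ` {i<..<j} \<subseteq> A"
proof -
  obtain i' j' where ij: "i' < j'" "z i' = z i" "z j' = b" "z i' \<notin> A" "z j' \<notin> A" "z ` {i'<..<j'} \<subseteq> A"
    using assms unfolding cells_iff by auto
  have "z (j' + (i - i')) = z j'" using z_succ_periodic[OF ij(2)[symmetric], of "j' - i'"]
    by (simp add: algebra_simps)
  moreover have "z ` {i<..<j' + (i - i')} \<subseteq> A"
  proof (rule image_subsetI)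
    fix t assume "t \<in> {i<..<j' + (i - i')}"
    then have "t - i + i' \<in> {i'<..<j'}" by auto
    then have "z (t - i + i') \<in> A" using ij(6) by blast
    moreover have "z (t - i + i') = z t"
      using z_succ_periodic[OF ij(2), of "t - i"] by (simp add: algebra_simps)
    ultimately show "z t \<in> A" by simp
  qed
  ultimately show ?thesis using that[of "j' + (i - i')"] ij by auto
qed

lemma cells_at_end:
  assumes "(a, z j) \<in> cells X Y A"
  obtains i where "i < j" "z i = a" "z i \<notin> A" "z j \<notin> A" "z ` {i<..<j} \<subseteq> A"
proof -
  obtain i' j' where ij: "i' < j'" "z i' = a" "z j' = z j" "z i' \<notin> A" "z j' \<notin> A" "z ` {i'<..<j'} \<subseteq> A"
    using assms unfolding cells_iff by auto
  have "z (i' + (j - j')) = z i'" using z_succ_periodic[OF ij(3)[symmetric], of "i' - j'"]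
    by (simp add: algebra_simps)
  moreover have "z ` {i' + (j - j')<..<j} \<subseteq> A"
  proof (rule image_subsetI)
    fix t assume "t \<in> {i' + (j - j')<..<j}"
    then have "t - j + j' \<in> {i'<..<j'}" by auto
    then have "z (t - j + j') \<in> A" using ij(6) by blast
    moreover have "z (t - j + j') = z t"
      using z_succ_periodic[OF ij(3), of "t - j"] by (simp add: algebra_simps)
    ultimately show "z t \<in> A" by simp
  qed
  ultimately show ?thesis using that[of "i' + (j - j')"] ij by auto
qed

lemma gaps_eq: "gaps L (X \<union> Y) = range gap"
proof (intro subset_antisym subsetI)
  fix G assume "G \<in> gaps L (X \<union> Y)"
  then obtain u v where G: "G = open_arc L u v" and "(u, v) \<in> cells X Y {}"
    by (auto simp: gaps_def cells_def)
  then obtain i j where ij: "i < j" "z i = u" "z j = v" "z ` {i<..<j} \<subseteq> {}"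
    unfolding cells_iff by auto
  then have "i + 1 \<notin> {i<..<j}" by blast
  then have "j = i + 1" using ij(1) by simp
  then show "G \<in> range gap" using G ij by (auto simp: gap_def)
next
  fix G assume "G \<in> range gap"
  then obtain i where "G = gap i" by auto
  moreover have "(z i, z (i + 1)) \<in> cells X Y {}"
    unfolding cells_iff by (intro exI[of _ i] exI[of _ "i + 1"]) auto
  ultimately show "G \<in> gaps L (X \<union> Y)"
    by (auto simp: gaps_def cells_def gap_def)
qed

end


subsection \<open>Certificates and optimality\<close>

lemma matchings_finite: "finite X \<Longrightarrow> finite Y \<Longrightarrow> finite (matchings X Y k)"
  by (rule finite_subset[of _ "Pow (X \<times> Y)"]) (auto simp: matchings_def)

text \<open>Common elements cancel, and the remaining parts have equal size and lie on opposite
  sides of \<open>\<beta>\<close>.\<close>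

lemma sum_le_sum_by_threshold:
  fixes \<phi> :: "'a \<Rightarrow> real"
  assumes "finite S" "finite B" "card S = card B"
    and "\<And>s. s \<in> S - B \<Longrightarrow> \<beta> \<le> \<phi> s" "\<And>b. b \<in> B - S \<Longrightarrow> \<phi> b \<le> \<beta>"
  shows "sum \<phi> B \<le> sum \<phi> S"
proof -
  have "card (S - B) = card (B - S)"
    using assms(1-3) by (simp add: card_Diff_subset_Int Int_commute)
  moreover have "\<beta> * card (S - B) \<le> sum \<phi> (S - B)"
    using sum_mono[of "S - B" "\<lambda>_. \<beta>" \<phi>] assms(4) by (simp add: mult.commute)
  moreover have "sum \<phi> (B - S) \<le> \<beta> * card (B - S)"
    using sum_mono[of "B - S" \<phi> "\<lambda>_. \<beta>"] assms(5) by (simp add: mult.commute)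
  moreover have "sum \<phi> S = sum \<phi> (S - B) + sum \<phi> (S \<inter> B)"
    using assms(1) by (metis add.commute sum.Int_Diff)
  moreover have "sum \<phi> B = sum \<phi> (B - S) + sum \<phi> (S \<inter> B)"
    using assms(2) by (metis add.commute sum.Int_Diff Int_commute)
  ultimately show ?thesis by simp
qed

context circle_atoms
begin

abbreviation len :: "int \<Rightarrow> real" where "len t \<equiv> P (t + 1) - P t"

text \<open>A flow \<open>f\<close> assigns to an atom the clockwise flow on the gap that follows it. \<open>fwd\<close> and \<open>bwd\<close>
  are the costs of one more unit in clockwise and counterclockwise direction.\<close>

definition fwd :: "(real \<Rightarrow> int) \<Rightarrow> int \<Rightarrow> real" where
  "fwd f t = (if 0 \<le> f (z t) then len t else - len t)"

definition bwd :: "(real \<Rightarrow> int) \<Rightarrow> int \<Rightarrow> real" where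
  "bwd f t = (if f (z t) \<le> 0 then len t else - len t)"

text \<open>The slope inequalities say that no residual direction has negative reduced cost. Against
  existing flow the cost is \<open>- len t\<close>, so they contain both the Lipschitz bound and
  complementary slackness.\<close>

definition certificate :: "real set \<Rightarrow> (real \<Rightarrow> int) \<Rightarrow> (real \<Rightarrow> real) \<Rightarrow> real \<Rightarrow> bool" where
  "certificate A f \<phi> \<beta> \<longleftrightarrow>
     A \<subseteq> X \<union> Y \<and>
     (\<forall>t. f (z t) - f (z (t - 1)) = (if z t \<in> A then \<sigma> t else 0)) \<and>
     (\<forall>t. z t \<notin> A \<longrightarrow> f (z t) = 0) \<and>
     (\<forall>t. \<phi> (z (t + 1)) - \<phi> (z t) \<le> fwd f t \<and> \<phi> (z t) - \<phi> (z (t + 1)) \<le> bwd f t) \<and>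
     (\<forall>a\<in>X. 0 \<le> \<phi> a \<and> (a \<notin> A \<longrightarrow> \<phi> a = 0)) \<and>
     (\<forall>b\<in>Y. \<phi> b \<le> \<beta> \<and> (b \<notin> A \<longrightarrow> \<phi> b = \<beta>))"

lemma len_pos: "len t > 0" by simp

lemma certificateD:
  assumes "certificate A f \<phi> \<beta>"
  shows "A \<subseteq> X \<union> Y"
    and "f (z t) - f (z (t - 1)) = (if z t \<in> A then \<sigma> t else 0)"
    and "z t \<notin> A \<Longrightarrow> f (z t) = 0"
    and "z t \<notin> A \<Longrightarrow> f (z (t - 1)) = 0"
    and "\<phi> (z (t + 1)) - \<phi> (z t) \<le> fwd f t"
    and "\<phi> (z t) - \<phi> (z (t + 1)) \<le> bwd f t"
    and "a \<in> X \<Longrightarrow> 0 \<le> \<phi> a" and "a \<in> X \<Longrightarrow> a \<notin> A \<Longrightarrow> \<phi> a = 0"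
    and "b \<in> Y \<Longrightarrow> \<phi> b \<le> \<beta>" and "b \<in> Y \<Longrightarrow> b \<notin> A \<Longrightarrow> \<phi> b = \<beta>"
proof -
  have f: "f (z t) - f (z (t - 1)) = (if z t \<in> A then \<sigma> t else 0)"
    and 0: "z t \<notin> A \<Longrightarrow> f (z t) = 0"
    using assms unfolding certificate_def by blast+
  show "z t \<notin> A \<Longrightarrow> f (z (t - 1)) = 0"
    using f 0 by simp
qed (use assms in \<open>unfold certificate_def, blast+\<close>)

lemma certificate_slope:
  assumes "certificate A f \<phi> \<beta>"
  shows "\<bar>\<phi> (z (t + 1)) - \<phi> (z t)\<bar> \<le> len t"
    and "f (z t) > 0 \<Longrightarrow> \<phi> (z (t + 1)) - \<phi> (z t) = len t"
    and "f (z t) < 0 \<Longrightarrow> \<phi> (z (t + 1)) - \<phi> (z t) = - len t"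
  using certificateD(5,6)[OF assms, of t] len_pos[of t]
  by (auto simp: fwd_def bwd_def simp del: P_less_iff split: if_splits)

lemma potential_lipschitz:
  assumes "certificate A f \<phi> \<beta>" "s \<le> t"
  shows "\<bar>\<phi> (z t) - \<phi> (z s)\<bar> \<le> P t - P s"
  using assms(2)
proof (induction t rule: int_ge_induct)
  case (step t)
  have "\<bar>\<phi> (z (t + 1)) - \<phi> (z t)\<bar> \<le> len t"
    by (rule certificate_slope[OF assms(1)])
  then show ?case using step.IH by linarith
qed simp

lemma potential_circle_dist:
  assumes "certificate A f \<phi> \<beta>" "a \<in> X \<union> Y" "b \<in> X \<union> Y"
  shows "\<bar>\<phi> b - \<phi> a\<bar> \<le> circle_dist L a b"
proof -
  have *: "\<bar>\<phi> b - \<phi> a\<bar> \<le> circle_dist L a b"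
    if ab: "a \<in> X \<union> Y" "b \<in> X \<union> Y" "a \<le> b" for a b
  proof -
    obtain i where i: "-1 < i" "i \<le> -1 + N" "z i = a" using z_surj[OF ab(1)] .
    obtain j where j: "-1 < j" "j \<le> -1 + N" "z j = b" using z_surj[OF ab(2)] .
    have P: "P i = a" "P j = b" using i j by (auto simp: P_def)
    then have ij: "i \<le> j" using ab(3) by (metis P_le_iff)
    \<comment> \<open>Continuing from \<open>b\<close> to the next copy of \<open>a\<close>
      traverses the complementary arc.\<close>
    have "j \<le> i + N" using i j by simp
    then have "\<bar>\<phi> (z (i + N)) - \<phi> (z j)\<bar> \<le> P (i + N) - P j"
      by (rule potential_lipschitz[OF assms(1)])
    then have "\<bar>\<phi> b - \<phi> a\<bar> \<le> L - (b - a)"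
      using i j P by (simp add: z_add_N P_add_N)
    moreover have "\<bar>\<phi> b - \<phi> a\<bar> \<le> b - a"
      using potential_lipschitz[OF assms(1) ij] i j P by simp
    ultimately show ?thesis
      using ab(3) by (simp add: circle_dist_def)
  qed
  show ?thesis
  proof (cases "a \<le> b")
    case False
    then have "\<bar>\<phi> a - \<phi> b\<bar> \<le> circle_dist L b a"
      using assms by (intro *) auto
    then show ?thesis by (simp add: circle_dist_def abs_minus_commute)
  qed (use * assms in auto)
qed

section \<open>Duality between flows and matchings\<close>

lemma sum_period:
  "(\<Sum>t\<in>{g<..g + N}. h (z t)) = sum h (X \<union> Y)"
  using sum.reindex[OF z_inj_on_period, of h g] by (simp add: z_image_period)

text \<open>Complementary slackness turns each length with flow into a potential increment;
  summation by parts then leaves the flow divergence, which is \<open>1\<close> at active sources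
  and \<open>-1\<close> at active targets.\<close>

lemma flow_cost_eq:
  assumes "certificate A f \<phi> \<beta>"
  shows "(\<Sum>t\<in>{g<..g + N}. len t * \<bar>real_of_int (f (z t))\<bar>) = sum \<phi> (A \<inter> Y) - sum \<phi> (A \<inter> X)"
proof -
  let ?I = "{g<..g + N}"
  \<comment> \<open>The boundary term of the summation by parts; being periodic, its differences sum
    to zero over a full turn.\<close>
  define h where "h t = f (z (t - 1)) * \<phi> (z t)" for t
  have tight: "len t * \<bar>real_of_int (f (z t))\<bar> = f (z t) * (\<phi> (z (t + 1)) - \<phi> (z t))" for t
  proof (cases "f (z t)" "0 :: int" rule: linorder_cases)
    case less
    have "f (z t) * (\<phi> (z (t + 1)) - \<phi> (z t)) = - (f (z t) * len t)"
      unfolding certificate_slope(3)[OF assms less] by (rule mult_minus_right)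
    then show ?thesis using less by (simp add: mult.commute)
  next
    case greater
    show ?thesis using greater unfolding certificate_slope(2)[OF assms greater] by (simp add: mult.commute)
  qed simp
  have "{g<..g + N} = {g + 1..<g + 1 + N}" by auto
  then have "(\<Sum>t\<in>?I. h (t + 1) - h t) = h (g + 1 + N) - h (g + 1)"
    using N_ge_2 sum_int_telescope[of "g + 1" "g + 1 + N" h] by simp
  also have "\<dots> = 0"
    using z_add_N(1)[of g] z_add_N(1)[of "g + 1"] by (simp add: h_def add.commute add.left_commute)
  finally have h0: "(\<Sum>t\<in>?I. h (t + 1) - h t) = 0" .
  have "len t * \<bar>real_of_int (f (z t))\<bar> =
      (h (t + 1) - h t) - (if z t \<in> A then if z t \<in> X then \<phi> (z t) else - \<phi> (z t) else 0)" for t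
  proof -
    have "real_of_int (f (z t)) = f (z (t - 1)) + (if z t \<in> A then \<sigma> t else 0)"
      using certificateD(2)[OF assms, of t] by simp
    then show ?thesis
      unfolding tight by (auto simp: h_def \<sigma>_def algebra_simps)
  qed
  then have "(\<Sum>t\<in>?I. len t * \<bar>real_of_int (f (z t))\<bar>) =
      - (\<Sum>a\<in>X \<union> Y. if a \<in> A then if a \<in> X then \<phi> a else - \<phi> a else 0)"
    using h0 sum_period[of "\<lambda>a. if a \<in> A then if a \<in> X then \<phi> a else - \<phi> a else 0" g]
    by (simp add: sum_subtractf)
  also have "(\<Sum>a\<in>X \<union> Y. if a \<in> A then if a \<in> X then \<phi> a else - \<phi> a else 0) =
      (\<Sum>a\<in>X. if a \<in> A then \<phi> a else 0) + (\<Sum>a\<in>Y. if a \<in> A then - \<phi> a else 0)"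
    using disjoint by (subst sum.union_disjoint[OF fin_X fin_Y disjoint])
      (intro arg_cong2[of _ _ _ _ "(+)"] sum.cong, auto)
  also have "\<dots> = sum \<phi> (A \<inter> X) - sum \<phi> (A \<inter> Y)"
    using fin_X fin_Y by (simp add: sum.inter_restrict Int_commute[of A] sum_negf flip: sum.inter_restrict)
  finally show ?thesis by simp
qed

lemma card_index_step:
  assumes "g \<le> r"
  shows "int (card {t \<in> {g<..r + 1}. z t \<in> S}) =
    int (card {t \<in> {g<..r}. z t \<in> S}) + (if z (r + 1) \<in> S then 1 else 0)"
proof -
  have "{t \<in> {g<..r + 1}. z t \<in> S} =
      (if z (r + 1) \<in> S then insert (r + 1) {t \<in> {g<..r}. z t \<in> S} else {t \<in> {g<..r}. z t \<in> S})"
    using assms by (auto simp: order.order_iff_strict zless_add1_eq)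
  moreover have "finite {t \<in> {g<..r}. z t \<in> S}"
    by (rule finite_subset[of _ "{g<..r}"]) auto
  ultimately show ?thesis by simp
qed

text \<open>Conservation telescopes from \<open>g\<close> to \<open>r\<close>. This identifies the
  flow with the counts in \<open>sorted_cost_eq_flow_cost\<close>.\<close>

lemma flow_eq_count:
  assumes "certificate A f \<phi> \<beta>" "g \<le> r"
  shows "f (z r) - f (z g) = int (card {t \<in> {g<..r}. z t \<in> A \<inter> X}) - int (card {t \<in> {g<..r}. z t \<in> A \<inter> Y})"
  using assms(2)
proof (induction r rule: int_ge_induct)
  case (step r)
  have "f (z (r + 1)) = f (z r) + (if z (r + 1) \<in> A then \<sigma> (r + 1) else 0)"
    using certificateD(2)[OF assms(1), of "r + 1"] by simp
  then show ?case
    unfolding card_index_step[OF step.hyps]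
    using step.IH z_notin_X_iff[of "r + 1"] disjoint by (auto simp only: \<sigma>_def Int_iff split: if_splits)
qed simp

text \<open>Weak duality: a pair costs at least its potential difference, and by the threshold
  comparison no \<open>k\<close> targets have a smaller potential sum than the active ones, no
  \<open>k\<close> sources a larger one.\<close>

lemma circle_cost_ge:
  assumes "certificate A f \<phi> \<beta>" "card (A \<inter> X) = k" "card (A \<inter> Y) = k" "M \<in> matchings X Y k"
  shows "sum \<phi> (A \<inter> Y) - sum \<phi> (A \<inter> X) \<le> (\<Sum>(a, b)\<in>M. circle_dist L a b)"
proof -
  have M: "M \<subseteq> X \<times> Y" "inj_on fst M" "inj_on snd M" "card M = k"
    using assms(4) by (auto simp: matchings_def)
  have sub: "fst ` M \<subseteq> X" "snd ` M \<subseteq> Y" using M(1) by auto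
  have crd: "card (fst ` M) = k" "card (snd ` M) = k"
    using M by (auto simp: card_image)
  have "sum \<phi> (A \<inter> Y) \<le> sum \<phi> (snd ` M)"
    using sub fin_Y crd assms(3) certificateD(9,10)[OF assms(1)]
    by (intro sum_le_sum_by_threshold[of _ _ \<beta>]) (auto intro: finite_subset)
  \<comment> \<open>The sign is reversed because inactive sources have the least potential among
    sources, whereas inactive targets have the greatest among targets.\<close>
  moreover have "sum (\<lambda>a. - \<phi> a) (A \<inter> X) \<le> sum (\<lambda>a. - \<phi> a) (fst ` M)"
    using sub fin_X crd assms(2) certificateD(7,8)[OF assms(1)]
    by (intro sum_le_sum_by_threshold[of _ _ 0]) (auto intro: finite_subset)
  ultimately have "sum \<phi> (A \<inter> Y) - sum \<phi> (A \<inter> X) \<le> sum \<phi> (snd ` M) - sum \<phi> (fst ` M)"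
    by (simp add: sum_negf)
  also have "\<dots> = (\<Sum>(a, b)\<in>M. \<phi> b - \<phi> a)"
    using M(2,3) by (simp add: sum.reindex sum_subtractf case_prod_beta)
  also have "\<dots> \<le> (\<Sum>(a, b)\<in>M. circle_dist L a b)"
  proof (intro sum_mono, clarify)
    fix a b assume "(a, b) \<in> M"
    then have "\<bar>\<phi> b - \<phi> a\<bar> \<le> circle_dist L a b"
      using M(1) by (intro potential_circle_dist[OF assms(1)]) auto
    then show "\<phi> b - \<phi> a \<le> circle_dist L a b" by simp
  qed
  finally show ?thesis .
qed

section \<open>Cutting at a gap without flow\<close>

lemma cut_position:
  assumes "\<theta> \<in> gap g" "g < s" "s \<le> g + N"
  shows "(z s - \<theta>) rmod L = P s - P g - clockwise L (z g) \<theta>"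
proof (rule rmod_unique)
  define c where "c = clockwise L (z g) \<theta>"
  have "z g \<noteq> z (g + 1)"
    using z_inj_on_period[of "g - 1"] N_ge_2 by (auto dest: inj_onD)
  \<comment> \<open>The cut lies strictly between \<open>P g\<close> and \<open>P (g + 1)\<close>,
    so the indices after \<open>g\<close> up to \<open>g + N\<close> list the atoms in cut
    order.\<close>
  then have c: "0 < c" "c < len g"
    using assms(1) N_ge_2 by (auto simp: gap_def open_arc_def c_def clockwise_z)
  have "P (g + 1) \<le> P s" "P s \<le> P g + L"
    using assms(2,3) by (simp_all flip: P_add_N)
  then have "0 \<le> P s - P g - c" "P s - P g - c < L"
    using c by linarith+
  then show "P s - P g - clockwise L (z g) \<theta> \<in> {0..<\<bar>L\<bar>}"
    using L_pos by (simp add: c_def)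
  have "c = \<theta> - z g - of_int \<lfloor>(\<theta> - z g) / L\<rfloor> * L"
    using L_pos by (simp add: c_def clockwise_def rmod_def)
  then show "z s - \<theta> = P s - P g - clockwise L (z g) \<theta> + of_int (g div N - s div N - \<lfloor>(\<theta> - z g) / L\<rfloor>) * L"
    unfolding c_def[symmetric] P_def of_int_diff left_diff_distrib by (simp add: mult.commute)
qed

text \<open>Since no flow crosses the gap, matching the active atoms in the order of their cut positions
  realises the flow.\<close>

lemma cut_matching:
  assumes cert: "certificate A f \<phi> \<beta>" "card (A \<inter> X) = k" "card (A \<inter> Y) = k"
    and "f (z g) = 0" "\<theta> \<in> gap g"
  obtains M where "M \<in> matchings X Y k"
    "(\<Sum>(a, b)\<in>M. \<bar>(a - \<theta>) rmod L - (b - \<theta>) rmod L\<bar>) =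
     (\<Sum>t\<in>{g<..g + N}. len t * \<bar>real_of_int (f (z t))\<bar>)"
proof -
  define S where "S = {s \<in> {g<..g + N}. z s \<in> A \<inter> X}"
  define T where "T = {s \<in> {g<..g + N}. z s \<in> A \<inter> Y}"
  define p where "p s = P s - P g - clockwise L (z g) \<theta>" for s
  have p_mono: "strict_mono p" by (simp add: p_def strict_mono_def)
  have fin: "finite S" "finite T" unfolding S_def T_def by (rule finite_subset[of _ "{g<..g + N}"]; auto)+
  have inj: "inj_on z S" "inj_on z T"
    by (auto simp: S_def T_def intro!: inj_on_subset[OF z_inj_on_period[of g]])
  have img: "z ` S = A \<inter> X" "z ` T = A \<inter> Y"
  proof -
    have img: "z ` {s \<in> {g<..g + N}. z s \<in> B} = (X \<union> Y) \<inter> B" for B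
      unfolding z_image_period[of g, symmetric] by auto
    show "z ` S = A \<inter> X" "z ` T = A \<inter> Y" unfolding S_def T_def img by auto
  qed
  have crd: "card S = k" "card T = k"
    using card_image[OF inj(1)] card_image[OF inj(2)] unfolding img assms(2,3) by simp_all
  define SS TT where "SS = sorted_list_of_set S" and "TT = sorted_list_of_set T"
  have SST: "set SS = S" "distinct SS" "length SS = k" "set TT = T" "distinct TT" "length TT = k"
    by (simp_all add: SS_def TT_def fin crd)
  have nthS: "SS ! i \<in> S" "TT ! i \<in> T" if "i < k" for i
    using that nth_mem[of i SS] nth_mem[of i TT] unfolding SST by simp_all
  have "inj_on (z \<circ> (!) SS) {..<k}" "inj_on (z \<circ> (!) TT) {..<k}"
    by (rule comp_inj_on; (rule inj_on_nth inj_on_subset[OF inj(1)] inj_on_subset[OF inj(2)])?;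
        use nthS SST in auto)+
  then have inj_i: "inj_on (\<lambda>i. z (SS ! i)) {..<k}" "inj_on (\<lambda>i. z (TT ! i)) {..<k}"
    by (simp_all add: o_def)
  define m where "m i = (z (SS ! i), z (TT ! i))" for i
  have inj_m: "inj_on m {..<k}" "inj_on (fst \<circ> m) {..<k}" "inj_on (snd \<circ> m) {..<k}"
    using inj_i by (auto simp: m_def o_def inj_on_def)
  show ?thesis
  proof
    have "m ` {..<k} \<subseteq> X \<times> Y"
      using nthS by (auto simp: m_def S_def T_def)
    then show "m ` {..<k} \<in> matchings X Y k"
      using inj_on_imageI[OF inj_m(2)] inj_on_imageI[OF inj_m(3)] card_image[OF inj_m(1)]
      by (simp add: matchings_def)
    have "(\<Sum>(a, b)\<in>m ` {..<k}. \<bar>(a - \<theta>) rmod L - (b - \<theta>) rmod L\<bar>) =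
        (\<Sum>i<k. \<bar>p (SS ! i) - p (TT ! i)\<bar>)"
      unfolding sum.reindex[OF inj_m(1)]
    proof (intro sum.cong refl)
      fix i assume "i \<in> {..<k}"
      then have "SS ! i \<in> {g<..g + N}" "TT ! i \<in> {g<..g + N}"
        using nthS[of i] by (auto simp: S_def T_def)
      then show "((\<lambda>(a, b). \<bar>(a - \<theta>) rmod L - (b - \<theta>) rmod L\<bar>) \<circ> m) i = \<bar>p (SS ! i) - p (TT ! i)\<bar>"
        by (simp add: m_def p_def cut_position[OF assms(5)])
    qed
    also have "\<dots> = sorted_cost 1 (p ` S) (p ` T)"
    proof -
      have "card (p ` S) = k"
        using crd p_mono by (subst card_image) (auto intro: strict_mono_imp_inj_on[THEN inj_on_subset])
      then show ?thesis
        using fin SST p_mono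
        by (simp add: sorted_cost_def sorted_list_of_set_image_strict_mono SS_def TT_def)
    qed
    also have "\<dots> = (\<Sum>r\<in>{g + 1..<g + N}. (p (r + 1) - p r) *
        \<bar>real (card {s \<in> S. s \<le> r}) - real (card {s \<in> T. s \<le> r})\<bar>)"
      using crd by (subst sorted_cost_eq_flow_cost[OF p_mono, where a = "g + 1" and b = "g + N"])
        (auto simp: S_def T_def)
    also have "\<dots> = (\<Sum>r\<in>{g + 1..<g + N}. len r * \<bar>real_of_int (f (z r))\<bar>)"
    proof (intro sum.cong refl)
      fix r assume r: "r \<in> {g + 1..<g + N}"
      have "{s \<in> S. s \<le> r} = {t \<in> {g<..r}. z t \<in> A \<inter> X}" "{s \<in> T. s \<le> r} = {t \<in> {g<..r}. z t \<in> A \<inter> Y}"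
        using r by (auto simp: S_def T_def)
      then have "f (z r) = int (card {s \<in> S. s \<le> r}) - int (card {s \<in> T. s \<le> r})"
        using flow_eq_count[OF cert(1), of g r] r assms(4) by simp
      then show "(p (r + 1) - p r) * \<bar>real (card {s \<in> S. s \<le> r}) - real (card {s \<in> T. s \<le> r})\<bar> =
          len r * \<bar>real_of_int (f (z r))\<bar>"
        by (simp add: p_def)
    qed
    also have "\<dots> = (\<Sum>t\<in>{g<..g + N}. len t * \<bar>real_of_int (f (z t))\<bar>)"
    proof -
      \<comment> \<open>The steps between the first and the last atom on the line omit the gap that
        is cut, index \<open>g + N\<close>; its flow is zero.\<close>
      have split: "{g<..g + N} = insert (g + N) {g + 1..<g + N}" using N_ge_2 by auto
      show ?thesis unfolding split using assms(4) by (simp add: z_add_N)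
    qed
    finally show "(\<Sum>(a, b)\<in>m ` {..<k}. \<bar>(a - \<theta>) rmod L - (b - \<theta>) rmod L\<bar>) =
        (\<Sum>t\<in>{g<..g + N}. len t * \<bar>real_of_int (f (z t))\<bar>)" .
  qed
qed

text \<open>Cut coordinates differ by \<open>a - b\<close> plus a whole number of turns. Without a
  turn this is the direct distance; otherwise its size is at least that of the complementary
  arc.\<close>

lemma circle_dist_le_cut:
  assumes "a \<in> {0..<L}" "b \<in> {0..<L}"
  shows "circle_dist L a b \<le> \<bar>(a - \<theta>) rmod L - (b - \<theta>) rmod L\<bar>"
proof -
  define j where "j = \<lfloor>(b - \<theta>) / L\<rfloor> - \<lfloor>(a - \<theta>) / L\<rfloor>"
  have eq: "(a - \<theta>) rmod L - (b - \<theta>) rmod L = a - b + of_int j * L"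
    using L_pos by (simp add: rmod_def j_def algebra_simps)
  show ?thesis
  proof (cases "j = 0")
    case True
    then show ?thesis unfolding eq by (simp add: circle_dist_def)
  next
    case False
    then have "1 \<le> \<bar>real_of_int j\<bar>" by linarith
    then have "1 * L \<le> \<bar>real_of_int j\<bar> * L" using L_pos by (intro mult_right_mono) auto
    then have "L \<le> \<bar>of_int j * L\<bar>" using L_pos by (simp add: abs_mult)
    then show ?thesis unfolding eq circle_dist_def by linarith
  qed
qed

text \<open>The dual lower bound for the circle is attained on the cut line, while every matching
  costs at least as much on the line as on the circle.\<close>

lemma line_cost_eq_circle_cost:
  assumes "certificate A f \<phi> \<beta>" "card (A \<inter> X) = k" "card (A \<inter> Y) = k" "f (z g) = 0"
  shows "line_cost L w X Y (gap g) k = circle_cost L w X Y k"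
proof -
  obtain \<theta> where \<theta>: "\<theta> \<in> gap g"
    using gaps_nonempty[OF fin_atoms range, of "gap g"] gaps_eq by auto
  let ?D = "\<lambda>a b. \<bar>(a - \<theta>) rmod L - (b - \<theta>) rmod L\<bar>"
  obtain M where M: "M \<in> matchings X Y k"
    "(\<Sum>(a, b)\<in>M. ?D a b) = sum \<phi> (A \<inter> Y) - sum \<phi> (A \<inter> X)"
    using cut_matching[OF assms \<theta>] unfolding flow_cost_eq[OF assms(1)] .
  have fin: "finite (matchings X Y k)" using fin_X fin_Y by (rule matchings_finite)
  have "matching_cost w ?D X Y k = matching_cost w (circle_dist L) X Y k"
  proof (rule antisym)
    show "matching_cost w ?D X Y k \<le> matching_cost w (circle_dist L) X Y k"
      unfolding matching_cost_def
    proof (rule Min.boundedI)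
      fix c assume "c \<in> (\<lambda>M. w * (\<Sum>(a, b)\<in>M. circle_dist L a b)) ` matchings X Y k"
      then obtain M' where M': "M' \<in> matchings X Y k" "c = w * (\<Sum>(a, b)\<in>M'. circle_dist L a b)"
        by auto
      have "Min ((\<lambda>M. w * (\<Sum>(a, b)\<in>M. ?D a b)) ` matchings X Y k) \<le> w * (\<Sum>(a, b)\<in>M. ?D a b)"
        using fin M(1) by (intro Min_le) auto
      also have "\<dots> \<le> c"
        using circle_cost_ge[OF assms(1-3) M'(1)] M(2) M'(2) w_pos by simp
      finally show "Min ((\<lambda>M. w * (\<Sum>(a, b)\<in>M. ?D a b)) ` matchings X Y k) \<le> c" .
    qed (use fin M(1) in auto)
    show "matching_cost w (circle_dist L) X Y k \<le> matching_cost w ?D X Y k"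
      unfolding matching_cost_def
    proof (rule Min.boundedI)
      fix c assume "c \<in> (\<lambda>M. w * (\<Sum>(a, b)\<in>M. ?D a b)) ` matchings X Y k"
      then obtain M' where M': "M' \<in> matchings X Y k" "c = w * (\<Sum>(a, b)\<in>M'. ?D a b)"
        by auto
      have "Min ((\<lambda>M. w * (\<Sum>(a, b)\<in>M. circle_dist L a b)) ` matchings X Y k)
          \<le> w * (\<Sum>(a, b)\<in>M'. circle_dist L a b)"
        using fin M'(1) by (intro Min_le) auto
      also have "\<dots> \<le> c"
        unfolding M'(2) using w_pos M'(1) range
        by (intro mult_left_mono sum_mono) (auto simp: matchings_def intro!: circle_dist_le_cut)
      finally show "Min ((\<lambda>M. w * (\<Sum>(a, b)\<in>M. circle_dist L a b)) ` matchings X Y k) \<le> c" .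
    qed (use fin M(1) in auto)
  qed
  then show ?thesis
    unfolding circle_cost_def cut_cost_def[symmetric]
    using line_cost_eq[OF fin_X fin_Y range _ \<theta>] gaps_eq by simp
qed


subsection \<open>Residual paths and the greedy step\<close>

text \<open>Residual cost of the path from \<open>i\<close> to \<open>j\<close> on the universal cover.\<close>

definition rc :: "(real \<Rightarrow> int) \<Rightarrow> int \<Rightarrow> int \<Rightarrow> real" where
  "rc f i j = (if i \<le> j then \<Sum>t\<in>{i..<j}. fwd f t else \<Sum>t\<in>{j..<i}. bwd f t)"

text \<open>With flow the two directions cancel; without flow each costs the gap length.\<close>

lemma fwd_bwd_nonneg: "0 \<le> fwd f t + bwd f t"
  using len_pos[of t] by (auto simp: fwd_def bwd_def simp del: P_less_iff)

lemma fwd_bwd_cong: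
  assumes "f (z s) = f' (z t)" "z s = z t"
  shows "fwd f s = fwd f' t" "bwd f s = bwd f' t"
  unfolding fwd_def bwd_def assms(1) P_diff_periodic[OF assms(2)] by simp_all

lemma rc_refl: "rc f i i = 0"
  by (simp add: rc_def)

lemma rc_split:
  assumes "i \<le> s" "s \<le> j"
  shows "rc f i j = rc f i s + rc f s j" "rc f j i = rc f j s + rc f s i"
proof -
  have split: "sum h {i..<j} = sum h {i..<s} + sum h {s..<j}" for h :: "int \<Rightarrow> real"
    using assms by (subst sum.union_disjoint[symmetric]) (auto simp: ivl_disj_un_two(3))
  have alt: "rc f b a = sum (bwd f) {a..<b}" if "a \<le> b" for a b
    using that by (auto simp: rc_def)
  show "rc f i j = rc f i s + rc f s j"
    using assms split[of "fwd f"] by (simp add: rc_def)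
  show "rc f j i = rc f j s + rc f s i"
    using assms split[of "bwd f"] by (simp add: alt)
qed

lemma rc_single: "rc f t (t + 1) = fwd f t" "rc f (t + 1) t = bwd f t"
proof -
  have "{t..<t + 1} = {t}" by auto
  then show "rc f t (t + 1) = fwd f t" "rc f (t + 1) t = bwd f t" by (simp_all add: rc_def)
qed

text \<open>One inequality is an equality, since the path to the farther index passes the nearer;
  the other pays for going back and forth, which \<open>fwd_bwd_nonneg\<close> bounds.\<close>

lemma rc_step:
  "rc f i (j + 1) \<le> rc f i j + fwd f j" "rc f i j \<le> rc f i (j + 1) + bwd f j"
proof -
  have "rc f i (j + 1) \<le> rc f i j + fwd f j \<and> rc f i j \<le> rc f i (j + 1) + bwd f j"
  proof (cases "i \<le> j")
    case True
    then show ?thesis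
      using rc_split(1)[of i j "j + 1" f] fwd_bwd_nonneg[of f j] by (simp add: rc_single)
  next
    case False
    then show ?thesis
      using rc_split(2)[of j "j + 1" i f] fwd_bwd_nonneg[of f j] by (simp add: rc_single)
  qed
  then show "rc f i (j + 1) \<le> rc f i j + fwd f j" "rc f i j \<le> rc f i (j + 1) + bwd f j"
    by auto
qed

lemma potential_diff_le_rc:
  assumes "certificate A f \<phi> \<beta>"
  shows "\<phi> (z j) - \<phi> (z i) \<le> rc f i j"
proof (cases "i \<le> j")
  case True
  then have "\<phi> (z j) - \<phi> (z i) = (\<Sum>t\<in>{i..<j}. \<phi> (z (t + 1)) - \<phi> (z t))"
    using sum_int_telescope[of i j "\<lambda>t. \<phi> (z t)"] by simp
  also have "\<dots> \<le> rc f i j"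
    using True certificateD(5)[OF assms] by (auto simp: rc_def intro: sum_mono)
  finally show ?thesis .
next
  case False
  then have "\<phi> (z j) - \<phi> (z i) = (\<Sum>t\<in>{j..<i}. \<phi> (z t) - \<phi> (z (t + 1)))"
    using sum_int_telescope[of j i "\<lambda>t. - \<phi> (z t)"] by simp
  also have "\<dots> \<le> rc f i j"
    using False certificateD(6)[OF assms] by (auto simp: rc_def intro: sum_mono)
  finally show ?thesis .
qed

section \<open>Marginals as residual costs\<close>

lemma card_filter_eq_of_bool:
  assumes "finite J" "i \<notin> J"
  shows "card {s \<in> insert i J. z s \<in> B} = card {s \<in> J. z s \<in> B} + of_bool (z i \<in> B)"
proof -
  have "{s \<in> insert i J. z s \<in> B} = (if z i \<in> B then insert i {s \<in> J. z s \<in> B} else {s \<in> J. z s \<in> B})"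
    by auto
  then show ?thesis using assms by simp
qed

text \<open>Inside the cell the flow is the excess of interior sources over interior targets, as it
  vanishes after \<open>z i\<close>. Including the endpoints shifts this excess by one unit on every
  gap of the cell, since \<open>z i\<close> precedes all of them and \<open>z j\<close> none. The
  cost change is that of pushing a unit from the source end to the target end.\<close>

lemma marginal_cell:
  assumes cert: "certificate A f \<phi> \<beta>" and ij: "i < j"
    and inactive: "z i \<notin> A" "z j \<notin> A" and sub: "z ` {i<..<j} \<subseteq> A"
    and opp: "z i \<in> X \<longleftrightarrow> z j \<in> Y"
  shows "marginal L w X Y (z i) (z j) = w * (if z i \<in> X then rc f i j else rc f j i)"
proof -
  have "z i \<noteq> z j" using opp disjoint z_notin_X_iff[of i] by auto
  have "j < i + N" using inactive(1) sub \<open>z i \<noteq> z j\<close> by (rule cell_width)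
  define p where "p s = P s - P i" for s
  have p_mono: "strict_mono p" by (simp add: p_def strict_mono_def)
  define S0 where "S0 B = {s \<in> {i<..<j}. z s \<in> B}" for B
  define S1 where "S1 B = {s \<in> {i..j}. z s \<in> B}" for B
  let ?I = "open_arc L (z i) (z j)" and ?t = "clockwise L (z i)"
  have pos: "?t (z s) = p s" if "s \<in> {i..j}" for s
    using that \<open>j < i + N\<close> by (simp add: clockwise_z p_def)
  have sub_ij: "S0 B \<subseteq> {i..j}" "S1 B \<subseteq> {i..j}" for B by (auto simp: S0_def S1_def)
  have I: "?I \<inter> (X \<union> Y) = z ` {i<..<j}"
    using ij \<open>j < i + N\<close> by (intro open_arc_z) auto
  have I0: "?t ` (B \<inter> ?I) = p ` S0 B" if "B \<subseteq> X \<union> Y" for B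
  proof -
    have "B \<inter> ?I = z ` {i<..<j} \<inter> B" using that unfolding I[symmetric] by blast
    also have "\<dots> = z ` S0 B" by (auto simp: S0_def)
    finally have eq: "B \<inter> ?I = z ` S0 B" .
    show ?thesis
      unfolding eq image_image using sub_ij(1) by (intro image_cong refl pos) blast
  qed
  have I1: "?t ` (B \<inter> (?I \<union> {z i, z j})) = p ` S1 B" if "B \<subseteq> X \<union> Y" for B
  proof -
    have "B \<inter> (?I \<union> {z i, z j}) = (z ` {i<..<j} \<union> {z i, z j}) \<inter> B"
      using that unfolding I[symmetric] by blast
    also have "z ` {i<..<j} \<union> {z i, z j} = z ` insert i (insert j {i<..<j})" by auto
    also have "insert i (insert j {i<..<j}) = {i..j}" using ij by auto
    also have "z ` {i..j} \<inter> B = z ` S1 B" by (auto simp: S1_def)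
    finally have eq: "B \<inter> (?I \<union> {z i, z j}) = z ` S1 B" .
    show ?thesis
      unfolding eq image_image using sub_ij(2) by (intro image_cong refl pos) blast
  qed
  have fi: "f (z i) = 0" by (rule certificateD(3)[OF cert inactive(1)])
  have fj: "f (z (j - 1)) = 0" by (rule certificateD(4)[OF cert inactive(2)])
  have below0: "f (z r) = int (card {s \<in> S0 X. s \<le> r}) - int (card {s \<in> S0 Y. s \<le> r})"
    if "r \<in> {i..<j}" for r
  proof -
    have "{t \<in> {i<..r}. z t \<in> A \<inter> B} = {s \<in> S0 B. s \<le> r}" for B
      using that sub by (auto simp: S0_def)
    then show ?thesis
      using flow_eq_count[OF cert, of i r] that fi by simp
  qed
  have below1: "card {s \<in> S1 B. s \<le> r} = card {s \<in> S0 B. s \<le> r} + of_bool (z i \<in> B)"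
    if "r \<in> {i..<j}" for r B
  proof -
    have "{s \<in> S1 B. s \<le> r} = {s \<in> insert i {i<..r}. z s \<in> B}" "{s \<in> S0 B. s \<le> r} = {s \<in> {i<..r}. z s \<in> B}"
      using that by (auto simp: S1_def S0_def)
    then show ?thesis by (simp only: card_filter_eq_of_bool finite_greaterThanAtMost_int greaterThanAtMost_iff less_irrefl simp_thms)
  qed
  \<comment> \<open>As the flow also vanishes before \<open>z j\<close>, the interior is balanced,
    as \<open>sorted_cost_eq_flow_cost\<close> requires.\<close>
  have "{s \<in> S0 B. s \<le> j - 1} = S0 B" for B by (auto simp: S0_def)
  then have card0: "card (S0 X) = card (S0 Y)"
    using below0[of "j - 1"] ij fj by simp
  have card1: "card (S1 B) = card (S0 B) + of_bool (z i \<in> B) + of_bool (z j \<in> B)" for B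
  proof -
    have eq: "S1 B = {s \<in> insert j (insert i {i<..<j}). z s \<in> B}"
      using ij by (auto simp: S1_def)
    have "card (S1 B) = card {s \<in> insert i {i<..<j}. z s \<in> B} + of_bool (z j \<in> B)"
      unfolding eq using ij by (intro card_filter_eq_of_bool) auto
    also have "card {s \<in> insert i {i<..<j}. z s \<in> B} = card (S0 B) + of_bool (z i \<in> B)"
      unfolding S0_def by (intro card_filter_eq_of_bool) auto
    finally show ?thesis .
  qed
  have card1': "card (S1 X) = card (S1 Y)"
    unfolding card1 card0 using opp z_notin_X_iff[of i] z_notin_X_iff[of j] by auto
  have p_diff: "p (r + 1) - p r = len r" for r by (simp add: p_def)
  have sums: "(\<Sum>r\<in>{i..<j}. len r * \<bar>real (card {s \<in> S1 X. s \<le> r}) - real (card {s \<in> S1 Y. s \<le> r})\<bar>) -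
      (\<Sum>r\<in>{i..<j}. len r * \<bar>real (card {s \<in> S0 X. s \<le> r}) - real (card {s \<in> S0 Y. s \<le> r})\<bar>) =
      (\<Sum>r\<in>{i..<j}. if z i \<in> X then fwd f r else bwd f r)"
    unfolding sum_subtractf[symmetric]
  proof (intro sum.cong refl)
    fix r assume r: "r \<in> {i..<j}"
    have eq0: "real (card {s \<in> S0 X. s \<le> r}) - real (card {s \<in> S0 Y. s \<le> r}) = of_int (f (z r))"
      using below0[OF r] by simp
    have eq1: "real (card {s \<in> S1 X. s \<le> r}) - real (card {s \<in> S1 Y. s \<le> r}) =
        of_int (f (z r) + (if z i \<in> X then 1 else -1))"
      unfolding below1[OF r] using below0[OF r] z_notin_X_iff[of i] by auto
    show "len r * \<bar>real (card {s \<in> S1 X. s \<le> r}) - real (card {s \<in> S1 Y. s \<le> r})\<bar> -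
        len r * \<bar>real (card {s \<in> S0 X. s \<le> r}) - real (card {s \<in> S0 Y. s \<le> r})\<bar> =
        (if z i \<in> X then fwd f r else bwd f r)"
    proof -
      \<comment> \<open>Integrality: a unit step from a nonzero value cannot cross zero, so the
        absolute value changes by exactly one.\<close>
      have "\<bar>real_of_int (f (z r) + (if z i \<in> X then 1 else -1))\<bar> - \<bar>real_of_int (f (z r))\<bar> =
          (if z i \<in> X then if 0 \<le> f (z r) then 1 else -1 else if f (z r) \<le> 0 then 1 else -1)"
        by (cases "f (z r)" "0 :: int" rule: linorder_cases) auto
      then show ?thesis
        unfolding eq0 eq1 right_diff_distrib[symmetric] by (simp add: fwd_def bwd_def)
    qed
  qed
  have "marginal L w X Y (z i) (z j) =
      w * (\<Sum>r\<in>{i..<j}. len r * \<bar>real (card {s \<in> S1 X. s \<le> r}) - real (card {s \<in> S1 Y. s \<le> r})\<bar>) -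
      w * (\<Sum>r\<in>{i..<j}. len r * \<bar>real (card {s \<in> S0 X. s \<le> r}) - real (card {s \<in> S0 Y. s \<le> r})\<bar>)"
    unfolding marginal_def Let_def I0[OF Un_upper1] I0[OF Un_upper2] I1[OF Un_upper1] I1[OF Un_upper2]
      sorted_cost_eq_flow_cost[OF p_mono sub_ij(1) sub_ij(1) card0]
      sorted_cost_eq_flow_cost[OF p_mono sub_ij(2) sub_ij(2) card1'] p_diff ..
  also have "\<dots> = w * (\<Sum>r\<in>{i..<j}. if z i \<in> X then fwd f r else bwd f r)"
    unfolding sums[symmetric] by (rule right_diff_distrib[symmetric])
  also have "\<dots> = w * (if z i \<in> X then rc f i j else rc f j i)"
    using ij by (simp add: rc_def)
  finally show ?thesis .
qed

text \<open>Segments between two inactive atoms of equal type have nonnegative residual cost, so a path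
  through several cells can be shortened to a single candidate cell.\<close>

lemma candidate_below_path:
  assumes cert: "certificate A f \<phi> \<beta>" and "i < j" and "z i \<notin> A" "z j \<notin> A"
    and "z i \<in> X \<longleftrightarrow> z j \<in> Y"
  shows "\<exists>(u, v)\<in>candidates X Y A. marginal L w X Y u v \<le> w * (if z i \<in> X then rc f i j else rc f j i)"
  using assms(2-5)
proof (induction "nat (j - i)" arbitrary: i j rule: less_induct)
  case less
  show ?case
  proof (cases "z ` {i<..<j} \<subseteq> A")
    case True
    have "(z i, z j) \<in> cells X Y A"
      unfolding cells_iff using less.prems True by blast
    then have "(z i, z j) \<in> candidates X Y A"
      using less.prems(4) z_notin_X_iff[of i] z_notin_X_iff[of j] by (auto simp: candidates_def)
    moreover have "marginal L w X Y (z i) (z j) = w * (if z i \<in> X then rc f i j else rc f j i)"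
      using less.prems True by (intro marginal_cell[OF cert])
    ultimately show ?thesis by (intro bexI[of _ "(z i, z j)"]) auto
  next
    case False
    then obtain s where "s \<in> {i<..<j}" "z s \<notin> A" by blast
    then have s: "i < s" "s < j" "z s \<notin> A" by auto
    \<comment> \<open>Inactive atoms of equal type have equal potential, so
      \<open>potential_diff_le_rc\<close> gives zero as a lower bound.\<close>
    have same: "0 \<le> rc f a b" if "z a \<notin> A" "z b \<notin> A" "z a \<in> X \<longleftrightarrow> z b \<in> X" for a b
      using potential_diff_le_rc[OF cert, of b a] that certificateD(8,10)[OF cert]
        z_notin_X_iff[of a] z_notin_X_iff[of b]
      by (cases "z a \<in> X") auto
    have split: "rc f i j = rc f i s + rc f s j" "rc f j i = rc f j s + rc f s i"
      using s by (auto intro: rc_split)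
    \<comment> \<open>The inactive atom \<open>z s\<close> shares its type with exactly one end; the
      segment towards that end is dropped and the induction applies to the other.\<close>
    show ?thesis
    proof (cases "z s \<in> X \<longleftrightarrow> z i \<in> X")
      case True
      then have "\<exists>(u, v)\<in>candidates X Y A. marginal L w X Y u v \<le> w * (if z s \<in> X then rc f s j else rc f j s)"
        using s less.prems by (intro less.hyps) auto
      moreover have "w * (if z s \<in> X then rc f s j else rc f j s) \<le> w * (if z i \<in> X then rc f i j else rc f j i)"
        using True same[of i s] same[of s i] s less.prems w_pos split by simp
      ultimately show ?thesis by (force intro: order_trans)
    next
      case False
      then have "\<exists>(u, v)\<in>candidates X Y A. marginal L w X Y u v \<le> w * (if z i \<in> X then rc f i s else rc f s i)"
        using s less.prems z_notin_X_iff[of s] by (intro less.hyps) auto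
      moreover have "w * (if z i \<in> X then rc f i s else rc f s i) \<le> w * (if z i \<in> X then rc f i j else rc f j i)"
        using False same[of s j] same[of j s] s less.prems w_pos split
          z_notin_X_iff[of j] z_notin_X_iff[of s] by auto
      ultimately show ?thesis by (force intro: order_trans)
    qed
  qed
qed

text \<open>The new potential is the residual distance from the inactive sources, capped.\<close>

lemma potential_update:
  assumes cert: "certificate A f \<phi> \<beta>" and x0: "z x0 \<in> X - A" and "\<beta> \<le> m"
    and m: "\<And>s t. z s \<in> X - A \<Longrightarrow> z t \<in> Y - A \<Longrightarrow> m \<le> rc f s t"
  shows "\<exists>\<phi>'. certificate A f \<phi>' m"
proof -
  \<comment> \<open>Paths on the cover from any index of an inactive source to any copy of
    \<open>a\<close>. There may be infinitely many costs, hence an infimum; the old potential bounds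
    it below.\<close>
  define R where "R a = {rc f s t | s t. z s \<in> X - A \<and> z t = a}" for a
  \<comment> \<open>The cap is the old potential raised by \<open>m - \<beta>\<close>: it is at most
    \<open>m\<close> on targets and equals \<open>m\<close> on inactive ones. A minimum of two
    functions obeying the slope bounds obeys them too.\<close>
  define \<phi>' where "\<phi>' a = min (Inf (R a)) (\<phi> a + (m - \<beta>))" for a
  have lower: "\<phi> a \<le> r" if r: "r \<in> R a" for r a
  proof -
    obtain s t where "z s \<in> X - A" "z t = a" "r = rc f s t" using r by (auto simp: R_def)
    then show ?thesis
      using potential_diff_le_rc[OF cert, of t s] certificateD(8)[OF cert, of "z s"] by simp
  qed
  have bdd: "bdd_below (R a)" for a
    using lower by (rule bdd_belowI)
  have ne: "R (z t) \<noteq> {}" for t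
    using x0 by (auto simp: R_def)
  have Inf_le: "Inf (R (z t)) \<le> rc f s t" if "z s \<in> X - A" for s t
    using that by (intro cInf_lower bdd) (auto simp: R_def)
  have Inf_ge: "\<phi> (z t) \<le> Inf (R (z t))" for t
    using ne lower by (rule cInf_greatest)
  \<comment> \<open>Appending one gap to a path to a copy of \<open>z t\<close> gives a path to a
    copy of the next atom; by periodicity the added cost is \<open>fwd f t\<close>.\<close>
  have fwd: "Inf (R (z (t + 1))) - fwd f t \<le> Inf (R (z t))" for t
  proof (rule cInf_greatest[OF ne])
    fix r assume "r \<in> R (z t)"
    then obtain s t' where st: "z s \<in> X - A" "z t' = z t" "r = rc f s t'" by (auto simp: R_def)
    have "Inf (R (z (t' + 1))) \<le> rc f s (t' + 1)" by (rule Inf_le[OF st(1)])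
    also have "\<dots> \<le> r + fwd f t'" unfolding st(3) by (rule rc_step)
    finally show "Inf (R (z (t + 1))) - fwd f t \<le> r"
      using z_succ_periodic[OF st(2), of 1] fwd_bwd_cong(1)[of f t' f t] st(2) by simp
  qed
  have bwd: "Inf (R (z t)) - bwd f t \<le> Inf (R (z (t + 1)))" for t
  proof (rule cInf_greatest[OF ne])
    fix r assume "r \<in> R (z (t + 1))"
    then obtain s t' where st: "z s \<in> X - A" "z t' = z (t + 1)" "r = rc f s t'" by (auto simp: R_def)
    have eq: "z (t' - 1) = z t" using z_succ_periodic[OF st(2), of "-1"] by simp
    have "Inf (R (z (t' - 1))) \<le> rc f s (t' - 1)" by (rule Inf_le[OF st(1)])
    also have "\<dots> \<le> r + bwd f (t' - 1)" unfolding st(3) using rc_step(2)[of f s "t' - 1"] by simp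
    finally show "Inf (R (z t)) - bwd f t \<le> r"
      using fwd_bwd_cong(2)[of f "t' - 1" f t] eq by simp
  qed
  have "certificate A f \<phi>' m"
    unfolding certificate_def
  proof (intro conjI allI ballI impI)
    fix t
    show "A \<subseteq> X \<union> Y" by (rule certificateD(1)[OF cert])
    show "f (z t) - f (z (t - 1)) = (if z t \<in> A then \<sigma> t else 0)" by (rule certificateD(2)[OF cert])
    show "f (z t) = 0" if "z t \<notin> A" using that by (rule certificateD(3)[OF cert])
    show "\<phi>' (z (t + 1)) - \<phi>' (z t) \<le> fwd f t"
      using fwd[of t] certificateD(5)[OF cert, of t] by (simp add: \<phi>'_def min_def)
    show "\<phi>' (z t) - \<phi>' (z (t + 1)) \<le> bwd f t"
      using bwd[of t] certificateD(6)[OF cert, of t] by (simp add: \<phi>'_def min_def)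
  next
    fix a assume a: "a \<in> X"
    then obtain t where t: "z t = a" using z_surj[of a 0] by blast
    show ge: "0 \<le> \<phi>' a"
      using Inf_ge[of t] t certificateD(7)[OF cert a] \<open>\<beta> \<le> m\<close> by (simp add: \<phi>'_def)
    show "\<phi>' a = 0" if "a \<notin> A"
      using Inf_le[of t t] that a t ge by (simp add: \<phi>'_def rc_refl)
  next
    fix b assume b: "b \<in> Y"
    then obtain t where t: "z t = b" using z_surj[of b 0] by blast
    show le: "\<phi>' b \<le> m"
      using certificateD(9)[OF cert b] by (simp add: \<phi>'_def)
    show "\<phi>' b = m" if "b \<notin> A"
    proof -
      have "m \<le> Inf (R (z t))"
        using that b t m by (intro cInf_greatest[OF ne]) (auto simp: R_def)
      then show ?thesis
        using le t certificateD(10)[OF cert b that] by (simp add: \<phi>'_def)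
    qed
  qed
  then show ?thesis by blast
qed

text \<open>The gap after \<open>z t\<close> lies in the current cell that starts at \<open>a\<close>.\<close>

definition cell_start :: "real set \<Rightarrow> int \<Rightarrow> real \<Rightarrow> bool" where
  "cell_start A t a \<longleftrightarrow> (\<exists>i\<le>t. z i = a \<and> z i \<notin> A \<and> z ` {i<..t} \<subseteq> A)"

text \<open>The start of the cell is the last inactive index up to \<open>t\<close>.\<close>

lemma cell_start_unique:
  assumes "cell_start A t a" "cell_start A t b"
  shows "a = b"
proof -
  obtain i where i: "i \<le> t" "z i = a" "z i \<notin> A" "z ` {i<..t} \<subseteq> A"
    using assms(1) by (auto simp: cell_start_def)
  obtain j where j: "j \<le> t" "z j = b" "z j \<notin> A" "z ` {j<..t} \<subseteq> A"
    using assms(2) by (auto simp: cell_start_def)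
  have "\<not> i < j" "\<not> j < i"
    using i j by (auto dest!: subsetD simp: image_subset_iff)
  then show ?thesis using i j by simp
qed

lemma cell_start_periodic:
  assumes "cell_start A t a" "z s = z t"
  shows "cell_start A s a"
proof -
  obtain i where i: "i \<le> t" "z i = a" "z i \<notin> A" "z ` {i<..t} \<subseteq> A"
    using assms(1) by (auto simp: cell_start_def)
  have shift: "z (c + s - t) = z c" for c
    using z_succ_periodic[OF assms(2), of "c - t"] by (simp add: algebra_simps)
  have "z ` {i + s - t<..s} \<subseteq> A"
  proof (rule image_subsetI)
    fix c assume "c \<in> {i + s - t<..s}"
    then have "c + t - s \<in> {i<..t}" by auto
    then have "z (c + t - s) \<in> A" using i(4) by blast
    then show "z c \<in> A" using shift[of "c + t - s"] by simp
  qed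
  then show ?thesis
    unfolding cell_start_def using i shift[of i] by (intro exI[of _ "i + s - t"]) simp
qed

text \<open>The sign \<open>\<sigma> i\<close> sends the unit from the source end to the target end.
  The potential stays the same: on tight gaps the newly opened reverse direction has reduced cost
  zero.\<close>

lemma flow_update:
  assumes cert: "certificate A f \<phi> m" and ij: "i < j"
    and inactive: "z i \<notin> A" "z j \<notin> A" and sub: "z ` {i<..<j} \<subseteq> A"
    and opp: "z i \<in> X \<longleftrightarrow> z j \<in> Y"
    and m: "m = (if z i \<in> X then rc f i j else rc f j i)"
  defines "f' \<equiv> \<lambda>a. f a + (if a \<in> z ` {i..<j} then \<sigma> i else 0)"
  shows "certificate (A \<union> {z i, z j}) f' \<phi> m"
proof -
  define D where "D = z ` {i..<j}"
  have f': "f' a = f a + (if a \<in> D then \<sigma> i else 0)" for a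
    by (simp add: f'_def D_def)
  have "z i \<noteq> z j" using opp disjoint z_notin_X_iff[of i] by auto
  have "j < i + N" using inactive(1) sub \<open>z i \<noteq> z j\<close> by (rule cell_width)
  have inj: "z s = z t \<longleftrightarrow> s = t" if "s \<in> {i..<i + N}" "t \<in> {i..<i + N}" for s t
    using that z_inj_on_period[of "i - 1"] by (auto dest: inj_onD)
  have D_iff: "z t \<in> D \<longleftrightarrow> t < j" if "t \<in> {i..<i + N}" for t
    using that inj \<open>j < i + N\<close> by (auto simp: D_def)
  \<comment> \<open>Flow added on \<open>D\<close> creates a jump \<open>\<sigma> i\<close> at
    \<open>z i\<close> and \<open>- \<sigma> i\<close> at \<open>z j\<close>. These are the
    divergences of the newly active atoms, whose types are opposite.\<close>
  have jump: "f' (z t) - f' (z (t - 1)) =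
      f (z t) - f (z (t - 1)) + (if z t = z i then \<sigma> i else if z t = z j then - \<sigma> i else 0)" for t
  proof -
    obtain s where s: "i - 1 < s" "s \<le> i - 1 + N" "z s = z t" using z_surj[OF z_mem] .
    then have s': "s \<in> {i..<i + N}" by auto
    have "z (s - 1) = z (t - 1)" using z_succ_periodic[OF s(3), of "-1"] by simp
    \<comment> \<open>For \<open>s = i\<close> the preceding index leaves the window; its copy
      \<open>i - 1 + N\<close> is outside \<open>D\<close> because \<open>j < i + N\<close>.\<close>
    moreover have "z (s - 1) \<in> D \<longleftrightarrow> i < s \<and> s \<le> j"
    proof (cases "s = i")
      case True
      then show ?thesis
        using D_iff[of "i - 1 + N"] \<open>j < i + N\<close> N_ge_2 z_add_N(1)[of "i - 1"] by simp
    qed (use D_iff[of "s - 1"] s' in auto)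
    moreover have "z s = z i \<longleftrightarrow> s = i" "z s = z j \<longleftrightarrow> s = j"
      using inj[OF s'] ij \<open>j < i + N\<close> by auto
    ultimately show ?thesis
      using D_iff[OF s'] s' ij unfolding f' s(3)[symmetric] by auto
  qed
  have \<sigma>: "\<sigma> t = (if z t = z i then \<sigma> i else - \<sigma> i)" if "z t = z i \<or> z t = z j" for t
    using that opp z_notin_X_iff[of i] z_notin_X_iff[of j] by (auto simp: \<sigma>_def)
  text \<open>The residual cost of the path equals its potential difference, so every gap on it is tight.\<close>
  have tight: "if z i \<in> X then \<phi> (z (t + 1)) - \<phi> (z t) = fwd f t else \<phi> (z t) - \<phi> (z (t + 1)) = bwd f t"
    if t: "t \<in> {i..<j}" for t
  proof (cases "z i \<in> X")
    case True
    let ?d = "\<lambda>t. fwd f t - (\<phi> (z (t + 1)) - \<phi> (z t))"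
    have "\<phi> (z j) - \<phi> (z i) = m"
      using True opp inactive certificateD(8,10)[OF cert] by simp
    then have "sum ?d {i..<j} = 0"
      using True m ij sum_int_telescope[of i j "\<lambda>t. \<phi> (z t)"] by (simp add: sum_subtractf rc_def)
    then have "?d t = 0"
      using t certificateD(5)[OF cert] by (subst (asm) sum_nonneg_eq_0_iff) auto
    then show ?thesis using True by simp
  next
    case False
    let ?d = "\<lambda>t. bwd f t - (\<phi> (z t) - \<phi> (z (t + 1)))"
    have "\<phi> (z i) - \<phi> (z j) = m"
      using False opp inactive certificateD(8,10)[OF cert] z_notin_X_iff[of i] z_notin_X_iff[of j] by simp
    then have "sum ?d {i..<j} = 0"
      using False m ij sum_int_telescope[of i j "\<lambda>t. - \<phi> (z t)"] by (simp add: sum_subtractf rc_def)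
    then have "?d t = 0"
      using t certificateD(6)[OF cert] by (subst (asm) sum_nonneg_eq_0_iff) auto
    then show ?thesis using False by simp
  qed
  have slope: "\<phi> (z (t + 1)) - \<phi> (z t) \<le> fwd f' t \<and> \<phi> (z t) - \<phi> (z (t + 1)) \<le> bwd f' t" for t
  proof (cases "z t \<in> D")
    case False
    then show ?thesis
      using certificateD(5,6)[OF cert, of t] by (simp add: fwd_def bwd_def f')
  next
    case True
    then obtain s where s: "s \<in> {i..<j}" "z s = z t" by (auto simp: D_def)
    have sD: "z s \<in> D" using s(1) by (simp add: D_def)
    have succ: "z (s + 1) = z (t + 1)" using z_succ_periodic[OF s(2)] .
    \<comment> \<open>After one more unit the reverse cost is exactly the negative of the old cost
      in the direction of the push, again by integrality, so tightness gives the reverse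
      inequality.\<close>
    have "\<phi> (z (s + 1)) - \<phi> (z s) \<le> fwd f' s \<and> \<phi> (z s) - \<phi> (z (s + 1)) \<le> bwd f' s"
    proof (cases "z i \<in> X")
      case True
      then have "f' (z s) = f (z s) + 1" using sD by (simp add: f' \<sigma>_def)
      moreover have "\<phi> (z (s + 1)) - \<phi> (z s) = fwd f s" using tight[OF s(1)] True by simp
      ultimately show ?thesis
        using len_pos[of s] by (auto simp: fwd_def bwd_def simp del: P_less_iff split: if_splits)
    next
      case False
      then have "f' (z s) = f (z s) - 1" using sD by (simp add: f' \<sigma>_def)
      moreover have "\<phi> (z s) - \<phi> (z (s + 1)) = bwd f s" using tight[OF s(1)] False by simp
      ultimately show ?thesis
        using len_pos[of s] by (auto simp: fwd_def bwd_def simp del: P_less_iff split: if_splits)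
    qed
    then show ?thesis
      using fwd_bwd_cong[of f' s f' t] s(2) succ by simp
  qed
  show ?thesis
    unfolding certificate_def
  proof (intro conjI allI ballI impI)
    fix t
    show "A \<union> {z i, z j} \<subseteq> X \<union> Y" using certificateD(1)[OF cert] z_mem by auto
    show "f' (z t) - f' (z (t - 1)) = (if z t \<in> A \<union> {z i, z j} then \<sigma> t else 0)"
      unfolding jump certificateD(2)[OF cert] using \<sigma>[of t] inactive \<open>z i \<noteq> z j\<close> by auto
    show "f' (z t) = 0" if "z t \<notin> A \<union> {z i, z j}"
    proof -
      have "{i..<j} = insert i {i<..<j}" using ij by auto
      then have "D \<subseteq> insert (z i) A" using sub by (simp add: D_def subset_insertI2)
      then show ?thesis using that certificateD(3)[OF cert, of t] by (auto simp: f')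
    qed
    show "\<phi> (z (t + 1)) - \<phi> (z t) \<le> fwd f' t" "\<phi> (z t) - \<phi> (z (t + 1)) \<le> bwd f' t"
      using slope[of t] by auto
  qed (use certificateD(7-10)[OF cert] in auto)
qed

text \<open>Two moves: the potential is raised to the level \<open>m\<close> with the flow fixed,
  then a unit is pushed through the chosen cell. The last clause records that gaps in every other
  cell keep their flow.\<close>

lemma greedy_step_certificate:
  assumes cert: "certificate A f \<phi> \<beta>" and choice: "greedy_choice L w X Y A u v"
  shows "\<exists>f' \<phi>' m. certificate (A \<union> {u, v}) f' \<phi>' m \<and>
           (\<forall>t a. cell_start A t a \<longrightarrow> a \<noteq> u \<longrightarrow> f' (z t) = f (z t))"
proof -
  have cand: "(u, v) \<in> candidates X Y A"
    and least: "\<And>u' v'. (u', v') \<in> candidates X Y A \<Longrightarrow> marginal L w X Y u v \<le> marginal L w X Y u' v'"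
    using choice by (auto simp: greedy_choice_def)
  obtain i j where ij: "i < j" "z i = u" "z j = v" "z i \<notin> A" "z j \<notin> A" "z ` {i<..<j} \<subseteq> A"
    using cand unfolding candidates_def cells_iff by auto
  have opp: "z i \<in> X \<longleftrightarrow> z j \<in> Y"
    using cand ij disjoint by (auto simp: candidates_def)
  define m where "m = (if z i \<in> X then rc f i j else rc f j i)"
  have marg: "marginal L w X Y u v = w * m"
    using marginal_cell[OF cert ij(1,4,5,6) opp] ij by (simp add: m_def)
  \<comment> \<open>Some candidate is no dearer than the path, and the selected one is no dearer
    than that candidate.\<close>
  have m_le: "m \<le> rc f s t" if st: "z s \<in> X - A" "z t \<in> Y - A" for s t
  proof -
    have "s \<noteq> t" using st disjoint by auto
    then have "\<exists>(u', v')\<in>candidates X Y A. marginal L w X Y u' v' \<le> w * rc f s t"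
      using candidate_below_path[OF cert, of s t] candidate_below_path[OF cert, of t s]
        st z_notin_X_iff[of s] z_notin_X_iff[of t] by (cases "s < t") auto
    then have "w * m \<le> w * rc f s t"
      using least marg by (auto intro: order_trans)
    then show ?thesis using w_pos by simp
  qed
  obtain x0 y0 where xy: "z x0 \<in> X - A" "z y0 \<in> Y - A" "m = rc f x0 y0"
  proof (cases "z i \<in> X")
    case True
    then show ?thesis using ij opp that[of i j] by (simp add: m_def)
  next
    case False
    then show ?thesis
      using ij opp that[of j i] z_notin_X_iff[of i] z_notin_X_iff[of j] by (simp add: m_def)
  qed
  \<comment> \<open>The old potential rises by \<open>\<beta>\<close> from an inactive source to an
    inactive target, so no path between them is cheaper.\<close>
  have "\<beta> \<le> m"
    using potential_diff_le_rc[OF cert, of y0 x0] xy certificateD(8,10)[OF cert] by simp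
  then obtain \<phi>' where cert': "certificate A f \<phi>' m"
    using potential_update[OF cert xy(1) _ m_le] by blast
  define f' where "f' = (\<lambda>a. f a + (if a \<in> z ` {i..<j} then \<sigma> i else 0))"
  have "certificate (A \<union> {u, v}) f' \<phi>' m"
    using flow_update[OF cert' ij(1,4,5,6) opp m_def] ij by (simp add: f'_def)
  moreover have "f' (z t) = f (z t)" if t: "cell_start A t a" "a \<noteq> u" for t a
  proof -
    have "z t \<notin> z ` {i..<j}"
    proof
      assume "z t \<in> z ` {i..<j}"
      then obtain s where s: "s \<in> {i..<j}" "z t = z s" by auto
      have "z ` {i<..s} \<subseteq> A" using s(1) ij(6) by (auto simp: image_subset_iff)
      then have "cell_start A s u"
        unfolding cell_start_def using s(1) ij by (intro exI[of _ i]) auto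
      then have "cell_start A t u" using s(2) by (rule cell_start_periodic)
      then show False using cell_start_unique[OF t(1)] t(2) by simp
    qed
    then show ?thesis by (simp add: f'_def)
  qed
  ultimately show ?thesis by blast
qed


subsection \<open>Runs of the greedy construction\<close>

text \<open>The equalities for all stages so far are carried along, because the flow
  \<open>f\<close> certifies only the current one. \<open>cell_start\<close> ties the representative
  to its cell, so that a step in another cell leaves its flow at zero.\<close>

definition greedy_inv :: "nat \<Rightarrow> real set \<Rightarrow> (real \<times> real \<Rightarrow> real set) \<Rightarrow> bool" where
  "greedy_inv k A \<rho> \<longleftrightarrow>
     (\<exists>f \<phi> \<beta>. certificate A f \<phi> \<beta> \<and> card (A \<inter> X) = k \<and> card (A \<inter> Y) = k \<and>
        (\<forall>a b. (a, b) \<in> cells X Y A \<longrightarrow>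
           (\<exists>g. \<rho> (a, b) = gap g \<and> f (z g) = 0 \<and> cell_start A g a \<and>
                (\<forall>l\<le>k. line_cost L w X Y (gap g) l = circle_cost L w X Y l))))"

lemma greedy_inv_certificate:
  assumes "greedy_inv k A \<rho>"
  shows "\<exists>f \<phi> \<beta>. certificate A f \<phi> \<beta> \<and> card (A \<inter> X) = k \<and> card (A \<inter> Y) = k"
  using assms unfolding greedy_inv_def by blast

lemma greedy_inv_start: "greedy_inv 0 {} (\<lambda>(u, v). open_arc L u v)"
proof -
  have cert: "certificate {} (\<lambda>_. 0) (\<lambda>_. 0) 0"
    using len_pos by (simp add: certificate_def fwd_def bwd_def less_imp_le)
  have "\<exists>g. open_arc L a b = gap g \<and> cell_start {} g a \<and>
          line_cost L w X Y (gap g) 0 = circle_cost L w X Y 0"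
    if ab: "(a, b) \<in> cells X Y {}" for a b
  proof -
    obtain i j where ij: "i < j" "z i = a" "z j = b" "z ` {i<..<j} \<subseteq> {}"
      using ab unfolding cells_iff by auto
    then have "i + 1 \<notin> {i<..<j}" by blast
    then have "j = i + 1" using ij(1) by simp
    then have "open_arc L a b = gap i" using ij by (simp add: gap_def)
    moreover have "cell_start {} i a" using ij by (auto simp: cell_start_def)
    moreover have "line_cost L w X Y (gap i) 0 = circle_cost L w X Y 0"
      using line_cost_eq_circle_cost[OF cert] by simp
    ultimately show ?thesis by blast
  qed
  then show ?thesis
    unfolding greedy_inv_def using cert by (intro exI[of _ "\<lambda>_. 0"] exI[of _ 0]) auto
qed

section \<open>How cells meet and merge\<close>

lemma candidate_endpoints:
  assumes "(u, v) \<in> candidates X Y A"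
  shows "u \<in> (X \<union> Y) - A" "v \<in> (X \<union> Y) - A" "u \<noteq> v" "u \<in> X \<longleftrightarrow> v \<in> Y"
  using assms disjoint cyclic_pairs_mem[of "X \<union> Y - A" u v] fin_atoms
  by (auto simp: candidates_def cells_def)

lemma candidate_card:
  assumes "(u, v) \<in> candidates X Y A" "A \<subseteq> X \<union> Y"
  shows "card ((A \<union> {u, v}) \<inter> X) = Suc (card (A \<inter> X))" "card ((A \<union> {u, v}) \<inter> Y) = Suc (card (A \<inter> Y))"
proof -
  have "(A \<union> {u, v}) \<inter> X = insert (if u \<in> X then u else v) (A \<inter> X)"
    "(A \<union> {u, v}) \<inter> Y = insert (if u \<in> X then v else u) (A \<inter> Y)"
    using candidate_endpoints[OF assms(1)] disjoint by auto
  moreover have "(if u \<in> X then u else v) \<notin> A \<inter> X" "(if u \<in> X then v else u) \<notin> A \<inter> Y"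
    using candidate_endpoints[OF assms(1)] by auto
  ultimately show "card ((A \<union> {u, v}) \<inter> X) = Suc (card (A \<inter> X))"
    "card ((A \<union> {u, v}) \<inter> Y) = Suc (card (A \<inter> Y))"
    using fin_X fin_Y by simp_all
qed

text \<open>Returning to the same atom takes at least one full turn, which meets every atom.\<close>

lemma cover_of_return:
  assumes "i < j" "z j = z i" "z ` {i<..j} \<subseteq> B"
  shows "X \<union> Y \<subseteq> B"
proof -
  obtain c where c: "j = i + c * N" using z_eqE[OF assms(2)] .
  have "0 < c * N" using assms(1) c by simp
  then have "1 \<le> c" using N_ge_2 by (simp add: zero_less_mult_iff)
  then have "1 * N \<le> c * N" using N_ge_2 by (intro mult_right_mono) auto
  then have "i + N \<le> j" using c by linarith
  then have "{i<..i + N} \<subseteq> {i<..j}" by auto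
  then show ?thesis using assms(3) z_image_period[of i] by blast
qed

lemma cells_loop:
  assumes "(u, u) \<in> cells X Y A"
  shows "X \<union> Y \<subseteq> A \<union> {u}"
proof -
  obtain i j where ij: "i < j" "z i = u" "z j = u" "z ` {i<..<j} \<subseteq> A"
    using assms unfolding cells_iff by auto
  have split: "{i<..j} = {j} \<union> {i<..<j}" using ij(1) by auto
  have "z ` {i<..j} \<subseteq> A \<union> {u}"
    unfolding split image_Un using ij(3,4) by blast
  then show ?thesis
    using ij(1-3) by (intro cover_of_return[of i j]) simp_all
qed

lemma cells_two:
  assumes "(u, v) \<in> cells X Y A" "(v, u) \<in> cells X Y A"
  shows "X \<union> Y \<subseteq> A \<union> {u, v}"
proof -
  obtain i j where ij: "i < j" "z i = u" "z j = v" "z ` {i<..<j} \<subseteq> A"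
    using assms(1) unfolding cells_iff by auto
  obtain h where h: "j < h" "z h = u" "z j \<notin> A" "z h \<notin> A" "z ` {j<..<h} \<subseteq> A"
    using cells_at_start[of j u A] assms(2) unfolding ij(3) .
  have split: "{i<..h} = {h} \<union> {j} \<union> {i<..<j} \<union> {j<..<h}" using ij(1) h(1) by auto
  have "z ` {i<..h} \<subseteq> A \<union> {u, v}"
    unfolding split image_Un using ij(3,4) h(2,5) by blast
  then show ?thesis
    using ij(1,2) h(1,2) by (intro cover_of_return[of i h]) simp_all
qed

lemma cells_succ_ex:
  assumes "z i \<notin> A"
  shows "\<exists>b. (z i, b) \<in> cells X Y A"
proof -
  define S where "S = {s \<in> {i<..i + N}. z s \<notin> A}"
  have "finite S" unfolding S_def by (rule finite_subset[of _ "{i<..i + N}"]) auto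
  \<comment> \<open>The copy \<open>i + N\<close> of \<open>i\<close> makes the set nonempty; it is
    the minimum only if no other atom is inactive, which gives the loop.\<close>
  moreover have "i + N \<in> S" using N_ge_2 assms by (simp add: S_def z_add_N)
  ultimately have S: "finite S" "S \<noteq> {}" by auto
  have "Min S \<in> S" using S by (rule Min_in)
  then have c: "i < Min S" "Min S \<le> i + N" "z (Min S) \<notin> A" by (simp_all add: S_def)
  have "z t \<in> A" if t: "t \<in> {i<..<Min S}" for t
  proof (rule ccontr)
    assume "z t \<notin> A"
    then have "t \<in> S" using t c(2) by (simp add: S_def)
    then have "Min S \<le> t" by (rule Min_le[OF S(1)])
    then show False using t by simp
  qed
  then have "(z i, z (Min S)) \<in> cells X Y A"
    unfolding cells_iff using assms c by blast
  then show ?thesis ..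
qed

lemma cells_pred_ex:
  assumes "z j \<notin> A"
  shows "\<exists>a. (a, z j) \<in> cells X Y A"
proof -
  define S where "S = {s \<in> {j - N..<j}. z s \<notin> A}"
  have "finite S" unfolding S_def by (rule finite_subset[of _ "{j - N..<j}"]) auto
  moreover have "j - N \<in> S" using N_ge_2 assms by (simp add: S_def z_add_N)
  ultimately have S: "finite S" "S \<noteq> {}" by auto
  have "Max S \<in> S" using S by (rule Max_in)
  then have c: "j - N \<le> Max S" "Max S < j" "z (Max S) \<notin> A" by (simp_all add: S_def)
  have "z t \<in> A" if t: "t \<in> {Max S<..<j}" for t
  proof (rule ccontr)
    assume "z t \<notin> A"
    then have "t \<in> S" using t c(1) by (simp add: S_def)
    then have "t \<le> Max S" by (rule Max_ge[OF S(1)])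
    then show False using t by simp
  qed
  then have "(z (Max S), z j) \<in> cells X Y A"
    unfolding cells_iff using assms c by blast
  then show ?thesis ..
qed

text \<open>A coincidence \<open>p = u\<close> or \<open>q = v\<close> would leave a single inactive
  atom, \<open>p = v\<close> or \<open>q = u\<close> only two. The case \<open>p = q\<close> remains
  possible.\<close>

lemma merge_endpoints:
  assumes "(u, v) \<in> candidates X Y A" "(X \<union> Y) - A \<noteq> {u, v}"
    and "(p, u) \<in> cells X Y A" "(v, q) \<in> cells X Y A"
  shows "p \<noteq> u" "p \<noteq> v" "q \<noteq> u" "q \<noteq> v"
proof -
  have uv: "(u, v) \<in> cells X Y A" using assms(1) by (auto simp: candidates_def)
  note ends = candidate_endpoints[OF assms(1)]
  have no_two: "(v, u) \<notin> cells X Y A"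
    using cells_two[OF uv] ends assms(2) by blast
  show "p \<noteq> v" "q \<noteq> u" using no_two assms(3,4) by auto
  show "p \<noteq> u" using cells_loop[of u A] assms(3) ends by blast
  show "q \<noteq> v" using cells_loop[of v A] assms(4) ends by blast
qed

text \<open>A new cell that crosses \<open>u\<close> or \<open>v\<close> must run through the three
  old cells in succession, so its ends are \<open>p\<close> and \<open>q\<close>.\<close>

lemma cells_after_merge:
  assumes cells: "(u, v) \<in> cells X Y A" "(p, u) \<in> cells X Y A" "(v, q) \<in> cells X Y A"
    and ne: "p \<notin> {u, v}" "q \<notin> {u, v}"
    and ab: "(a, b) \<in> cells X Y (A \<union> {u, v})"
  shows "(a, b) = (p, q) \<or> (a, b) \<in> cells X Y A"
proof -
  obtain i j where ij: "i < j" "z i = a" "z j = b" "z i \<notin> A \<union> {u, v}" "z j \<notin> A \<union> {u, v}"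
      "z ` {i<..<j} \<subseteq> A \<union> {u, v}"
    using ab unfolding cells_iff by auto
  have inside: "z t \<in> A \<union> {u, v}" if "i < t" "t < j" for t
    using that ij(6) by (simp add: image_subset_iff)
  \<comment> \<open>The three old cells are laid out on the cover around \<open>t\<close>; the
    inactive indices found there pin both ends.\<close>
  have via_u: "(a, b) = (p, q)" if t: "i < t" "t < j" "z t = u" for t
  proof -
    obtain h where h: "h < t" "z h = p" "z h \<notin> A" "z t \<notin> A" "z ` {h<..<t} \<subseteq> A"
      using cells_at_end[of p t A] cells(2) unfolding t(3) .
    have "\<not> i < h" using inside[of h] h t ne by auto
    moreover have "\<not> h < i" using h(5) t ij(4) by (auto simp: image_subset_iff)
    ultimately have "a = p" using h(2) ij(2) by simp
    obtain t' where t': "t < t'" "z t' = v" "z t \<notin> A" "z t' \<notin> A" "z ` {t<..<t'} \<subseteq> A"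
      using cells_at_start[of t v A] cells(1) unfolding t(3) .
    have "\<not> j < t'" using t'(5) t ij(5) by (auto simp: image_subset_iff)
    then have "t' < j" using ij(5) t' by (cases "t' = j") auto
    obtain s where s: "t' < s" "z s = q" "z t' \<notin> A" "z s \<notin> A" "z ` {t'<..<s} \<subseteq> A"
      using cells_at_start[of t' q A] cells(3) unfolding t'(2) .
    have "\<not> j < s" using s(5) \<open>t' < j\<close> ij(5) by (auto simp: image_subset_iff)
    moreover have "\<not> s < j" using inside[of s] s t t' ne by auto
    ultimately have "b = q" using s(2) ij(3) by simp
    then show ?thesis using \<open>a = p\<close> by simp
  qed
  show ?thesis
  proof (cases "z ` {i<..<j} \<subseteq> A")
    case True
    then have "(a, b) \<in> cells X Y A" unfolding cells_iff using ij by auto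
    then show ?thesis ..
  next
    case False
    then obtain t where "t \<in> {i<..<j}" "z t \<notin> A" by blast
    then have t: "i < t" "t < j" "z t \<notin> A" by auto
    then consider "z t = u" | "z t = v" using inside[of t] by auto
    then show ?thesis
    proof cases
      case 1
      then show ?thesis using via_u t by blast
    next
      case 2
      obtain s where s: "s < t" "z s = u" "z s \<notin> A" "z t \<notin> A" "z ` {s<..<t} \<subseteq> A"
        using cells_at_end[of u t A] cells(1) unfolding 2 .
      have "\<not> s < i" using s(5) t ij(4) by (auto simp: image_subset_iff)
      then have "i < s" using ij(4) s by (cases "s = i") auto
      then show ?thesis using via_u[of s] s t by simp
    qed
  qed
qed

lemma cell_start_mono:
  assumes "cell_start A t a" "A \<subseteq> B" "a \<notin> B"
  shows "cell_start B t a"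
  using assms unfolding cell_start_def by blast

text \<open>The step pushes flow only in the cell starting at \<open>u\<close>, so representatives
  of all other old cells stay free of flow and gain the equality for \<open>Suc k\<close>. Either
  neighbour may hand on its representative, since \<open>p\<close> and \<open>v\<close> both differ
  from \<open>u\<close>.\<close>

lemma greedy_inv_merge:
  assumes inv: "greedy_inv k A \<rho>" and choice: "greedy_choice L w X Y A u v"
    and rest: "(X \<union> Y) - A \<noteq> {u, v}"
    and pu: "(p, u) \<in> cells X Y A" and vq: "(v, q) \<in> cells X Y A"
    and G: "G = \<rho> (p, u) \<or> G = \<rho> (v, q)"
  shows "greedy_inv (Suc k) (A \<union> {u, v}) (\<rho>((p, q) := G))"
proof -
  have cand: "(u, v) \<in> candidates X Y A" using choice by (simp add: greedy_choice_def)
  then have uv: "(u, v) \<in> cells X Y A" by (auto simp: candidates_def)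
  note ends = candidate_endpoints[OF cand]
  note ne = merge_endpoints[OF cand rest pu vq]
  obtain f \<phi> \<beta> where cert: "certificate A f \<phi> \<beta>"
    and crd: "card (A \<inter> X) = k" "card (A \<inter> Y) = k"
    and rep: "\<forall>a b. (a, b) \<in> cells X Y A \<longrightarrow>
       (\<exists>g. \<rho> (a, b) = gap g \<and> f (z g) = 0 \<and> cell_start A g a \<and>
           (\<forall>l\<le>k. line_cost L w X Y (gap g) l = circle_cost L w X Y l))"
    using inv unfolding greedy_inv_def by blast
  let ?A = "A \<union> {u, v}"
  obtain f' \<phi>' m where cert': "certificate ?A f' \<phi>' m"
    and keep: "\<And>t a. cell_start A t a \<Longrightarrow> a \<noteq> u \<Longrightarrow> f' (z t) = f (z t)"
    using greedy_step_certificate[OF cert choice] by blast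
  have crd': "card (?A \<inter> X) = Suc k" "card (?A \<inter> Y) = Suc k"
    using candidate_card[OF cand certificateD(1)[OF cert]] crd by simp_all
  have extend: "\<forall>l\<le>Suc k. line_cost L w X Y (gap g) l = circle_cost L w X Y l"
    if "f' (z g) = 0" "\<forall>l\<le>k. line_cost L w X Y (gap g) l = circle_cost L w X Y l" for g
    using that line_cost_eq_circle_cost[OF cert' crd'] by (auto simp: le_Suc_eq)
  have old: "\<exists>g. \<rho> (a, b) = gap g \<and> f' (z g) = 0 \<and> cell_start A g a \<and>
      (\<forall>l\<le>Suc k. line_cost L w X Y (gap g) l = circle_cost L w X Y l)"
    if cell: "(a, b) \<in> cells X Y A" and "a \<noteq> u" for a b
  proof -
    obtain g where g: "\<rho> (a, b) = gap g" "f (z g) = 0" "cell_start A g a"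
      "\<forall>l\<le>k. line_cost L w X Y (gap g) l = circle_cost L w X Y l"
      using rep[rule_format, OF cell] by blast
    have "f' (z g) = 0" using keep[OF g(3) \<open>a \<noteq> u\<close>] g(2) by simp
    then show ?thesis using g extend by blast
  qed
  have p: "p \<notin> ?A" using pu ne unfolding cells_iff by auto
  \<comment> \<open>After the merge, a gap of the old cell from \<open>v\<close> belongs to the cell
    from \<open>p\<close>; the three stretches are glued on the cover.\<close>
  have start_v: "cell_start ?A g p" if g: "cell_start A g v" for g
  proof -
    obtain i where i: "i \<le> g" "z i = v" "z i \<notin> A" "z ` {i<..g} \<subseteq> A"
      using g unfolding cell_start_def by blast
    obtain h where h: "h < i" "z h = u" "z h \<notin> A" "z i \<notin> A" "z ` {h<..<i} \<subseteq> A"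
      using cells_at_end[of u i A] uv unfolding i(2) .
    obtain h0 where h0: "h0 < h" "z h0 = p" "z h0 \<notin> A" "z h \<notin> A" "z ` {h0<..<h} \<subseteq> A"
      using cells_at_end[of p h A] pu unfolding h(2) .
    have split: "{h0<..g} = {h0<..<h} \<union> {h} \<union> {h<..<i} \<union> {i} \<union> {i<..g}"
      using i(1) h(1) h0(1) by auto
    have "z ` {h0<..g} \<subseteq> ?A"
      unfolding split image_Un using i(2,4) h(2,5) h0(5) by blast
    then show ?thesis
      unfolding cell_start_def using h0 p i(1) h(1) by (intro exI[of _ h0]) auto
  qed
  have merged: "\<exists>g. G = gap g \<and> f' (z g) = 0 \<and> cell_start ?A g p \<and>
      (\<forall>l\<le>Suc k. line_cost L w X Y (gap g) l = circle_cost L w X Y l)"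
    using G
  proof
    assume "G = \<rho> (p, u)"
    then show ?thesis using old[OF pu ne(1)] cell_start_mono[OF _ _ p] by blast
  next
    assume "G = \<rho> (v, q)"
    then show ?thesis using old[OF vq] ends(3) start_v by metis
  qed
  have "\<exists>g. (\<rho>((p, q) := G)) (a, b) = gap g \<and> f' (z g) = 0 \<and> cell_start ?A g a \<and>
      (\<forall>l\<le>Suc k. line_cost L w X Y (gap g) l = circle_cost L w X Y l)"
    if cell: "(a, b) \<in> cells X Y ?A" for a b
  proof (cases "(a, b) = (p, q)")
    case True
    then show ?thesis using merged by simp
  next
    case False
    then have "(a, b) \<in> cells X Y A"
      using cells_after_merge[OF uv pu vq _ _ cell] ne by blast
    moreover have a: "a \<notin> ?A" using cell unfolding cells_iff by auto
    ultimately show ?thesis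
      using old[of a b] False cell_start_mono[OF _ _ a] by auto
  qed
  then show ?thesis
    unfolding greedy_inv_def using cert' crd' by blast
qed

lemma greedy_state_inv: "greedy_state L w X Y k A \<rho> \<Longrightarrow> greedy_inv k A \<rho>"
  by (induction rule: greedy_state.induct) (rule greedy_inv_start, rule greedy_inv_merge)

section \<open>Existence of runs and optimality of their outputs\<close>

lemma greedy_choice_ex:
  assumes "greedy_inv k A \<rho>" "k < min (card X) (card Y)"
  shows "\<exists>u v. greedy_choice L w X Y A u v"
proof -
  obtain f \<phi> \<beta> where cert: "certificate A f \<phi> \<beta>" and crd: "card (A \<inter> X) = k" "card (A \<inter> Y) = k"
    using greedy_inv_certificate[OF assms(1)] by blast
  \<comment> \<open>Counting leaves an inactive atom of each type, and the path between the two
    yields a candidate.\<close>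
  have "A \<inter> X \<noteq> X" "A \<inter> Y \<noteq> Y" using crd assms(2) by auto
  then obtain a b where a: "a \<in> X - A" and b: "b \<in> Y - A" by blast
  then obtain i where i: "0 < i" "i \<le> 0 + N" "z i = a" using z_surj[of a 0] by blast
  obtain j where j: "i < j" "j \<le> i + N" "z j = b" using z_surj[of b i] b by blast
  have "candidates X Y A \<noteq> {}"
    using candidate_below_path[OF cert j(1)] i j a b by auto
  moreover have "finite (candidates X Y A)"
  proof (rule finite_subset)
    show "candidates X Y A \<subseteq> (X \<union> Y) \<times> (X \<union> Y)"
      by (rule subrelI) (use candidate_endpoints(1,2)[of _ _ A] in blast)
  qed (use fin_atoms in blast)
  ultimately obtain c where "is_arg_min (\<lambda>(u, v). marginal L w X Y u v) (\<lambda>c. c \<in> candidates X Y A) c"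
    using ex_is_arg_min_if_finite by metis
  then show ?thesis
    unfolding is_arg_min_linorder greedy_choice_def by (cases c) auto
qed

text \<open>With equally many sources and targets the last step leaves no state, so the second
  assumption excludes it. In the other cases counting shows that the two chosen atoms are not the
  only inactive ones.\<close>

lemma greedy_state_ex:
  assumes "k \<le> min (card X) (card Y)" "k < min (card X) (card Y) \<or> card X \<noteq> card Y"
  shows "\<exists>A \<rho>. greedy_state L w X Y k A \<rho>"
  using assms
proof (induction k)
  case 0
  show ?case using greedy_state.start by blast
next
  case (Suc k)
  then have k: "k < min (card X) (card Y)" by simp
  then obtain A \<rho> where st: "greedy_state L w X Y k A \<rho>" using Suc.IH by auto
  have inv: "greedy_inv k A \<rho>" using st by (rule greedy_state_inv)
  obtain u v where choice: "greedy_choice L w X Y A u v" using greedy_choice_ex[OF inv k] by blast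
  then have cand: "(u, v) \<in> candidates X Y A" by (simp add: greedy_choice_def)
  note ends = candidate_endpoints[OF cand]
  obtain f \<phi> \<beta> where cert: "certificate A f \<phi> \<beta>" and crd: "card (A \<inter> X) = k" "card (A \<inter> Y) = k"
    using greedy_inv_certificate[OF inv] by blast
  have "(X \<union> Y) - A \<noteq> {u, v}"
  proof
    assume "(X \<union> Y) - A = {u, v}"
    then have "(A \<union> {u, v}) \<inter> X = X" "(A \<union> {u, v}) \<inter> Y = Y" by blast+
    then have "card X = Suc k" "card Y = Suc k"
      using candidate_card[OF cand certificateD(1)[OF cert]] crd by simp_all
    then show False using Suc.prems by simp
  qed
  moreover obtain p where "(p, u) \<in> cells X Y A"
    using cells_pred_ex[of _ A] z_surj[of u 0] ends(1) by (metis DiffD1 DiffD2)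
  moreover obtain q where "(v, q) \<in> cells X Y A"
    using cells_succ_ex[of _ A] z_surj[of v 0] ends(2) by (metis DiffD1 DiffD2)
  ultimately show ?case using greedy_state.merge[OF st k choice] by blast
qed

text \<open>The next inactive atom after \<open>v\<close> is \<open>u\<close> or \<open>v\<close>,
  and a loop at \<open>v\<close> would make \<open>u\<close> active.\<close>

lemma closing_cell:
  assumes "(u, v) \<in> candidates X Y A" "(X \<union> Y) - A = {u, v}"
  shows "(v, u) \<in> cells X Y A"
proof -
  note ends = candidate_endpoints[OF assms(1)]
  obtain i where "0 < i" "i \<le> 0 + N" "z i = v" using z_surj[of v 0] ends(2) by blast
  then obtain q where q: "(v, q) \<in> cells X Y A" using cells_succ_ex[of i A] ends(2) by auto
  have "q \<in> {u, v}"
    using q z_mem assms(2) unfolding cells_iff by blast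
  moreover have "q \<noteq> v" using cells_loop[of v A] q ends by blast
  ultimately show ?thesis using q by auto
qed

lemma greedy_output_ex: "\<exists>G. greedy_output L w X Y G"
proof (cases "card X = card Y")
  case False
  obtain A \<rho> where st: "greedy_state L w X Y (min (card X) (card Y)) A \<rho>"
    using greedy_state_ex[of "min (card X) (card Y)"] False by blast
  obtain f \<phi> \<beta> where crd: "card (A \<inter> X) = min (card X) (card Y)" "card (A \<inter> Y) = min (card X) (card Y)"
    using greedy_inv_certificate[OF greedy_state_inv[OF st]] by blast
  have "\<not> X \<union> Y \<subseteq> A"
  proof
    assume "X \<union> Y \<subseteq> A"
    then have "A \<inter> X = X" "A \<inter> Y = Y" by auto
    then show False using crd False by simp
  qed
  then obtain a where a: "a \<in> X \<union> Y" "a \<notin> A" by auto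
  obtain i where "0 < i" "i \<le> 0 + N" "z i = a" using z_surj[OF a(1)] .
  then obtain b where "(a, b) \<in> cells X Y A" using cells_succ_ex[of i A] a by auto
  then show ?thesis using greedy_output.remaining[OF False st] by blast
next
  case True
  \<comment> \<open>The stage before the last step, at which exactly two atoms are inactive.\<close>
  define k where "k = card X - 1"
  have "card X > 0" using X_ne fin_X by (simp add: card_gt_0_iff)
  then have k: "k < min (card X) (card Y)" "Suc k = card X" using True by (auto simp: k_def)
  obtain A \<rho> where st: "greedy_state L w X Y k A \<rho>"
    using greedy_state_ex[of k] k by auto
  have inv: "greedy_inv k A \<rho>" using st by (rule greedy_state_inv)
  obtain u v where choice: "greedy_choice L w X Y A u v" using greedy_choice_ex[OF inv k(1)] by blast
  then have cand: "(u, v) \<in> candidates X Y A" by (simp add: greedy_choice_def)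
  obtain f \<phi> \<beta> where cert: "certificate A f \<phi> \<beta>" and crd: "card (A \<inter> X) = k" "card (A \<inter> Y) = k"
    using greedy_inv_certificate[OF inv] by blast
  have "(A \<union> {u, v}) \<inter> X = X" "(A \<union> {u, v}) \<inter> Y = Y"
    using candidate_card[OF cand certificateD(1)[OF cert]] crd k True
      card_subset_eq[OF fin_X Int_lower2] card_subset_eq[OF fin_Y Int_lower2] by simp_all
  then have "(X \<union> Y) - A = {u, v}"
    using candidate_endpoints[OF cand] by blast
  then show ?thesis using greedy_output.closing[OF st k(1) choice] by blast
qed

text \<open>A closing step produces no state, so the certificate after it is built here. Its output
  comes from the cell starting at \<open>v\<close>, which differs from \<open>u\<close>, and keeps
  zero flow in that step.\<close>

lemma greedy_output_optimal:
  assumes "greedy_output L w X Y G"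
  shows "G \<in> gaps L (X \<union> Y) \<and>
    (\<forall>k\<le>min (card X) (card Y). line_cost L w X Y G k = circle_cost L w X Y k)"
  using assms
proof cases
  case (closing k A \<rho> u v)
  have inv: "greedy_inv k A \<rho>" using closing by (intro greedy_state_inv)
  have cand: "(u, v) \<in> candidates X Y A" using closing by (simp add: greedy_choice_def)
  obtain f \<phi> \<beta> where cert: "certificate A f \<phi> \<beta>"
    and crd: "card (A \<inter> X) = k" "card (A \<inter> Y) = k"
    and rep: "\<forall>a b. (a, b) \<in> cells X Y A \<longrightarrow>
       (\<exists>g. \<rho> (a, b) = gap g \<and> f (z g) = 0 \<and> cell_start A g a \<and>
           (\<forall>l\<le>k. line_cost L w X Y (gap g) l = circle_cost L w X Y l))"
    using inv unfolding greedy_inv_def by blast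
  obtain g where g: "G = gap g" "f (z g) = 0" "cell_start A g v"
    "\<forall>l\<le>k. line_cost L w X Y (gap g) l = circle_cost L w X Y l"
    using rep[rule_format, OF closing_cell[OF cand closing(5)]] closing(1) by auto
  obtain f' \<phi>' m where cert': "certificate (A \<union> {u, v}) f' \<phi>' m"
    and keep: "\<And>t a. cell_start A t a \<Longrightarrow> a \<noteq> u \<Longrightarrow> f' (z t) = f (z t)"
    using greedy_step_certificate[OF cert closing(4)] by blast
  have crd': "card ((A \<union> {u, v}) \<inter> X) = Suc k" "card ((A \<union> {u, v}) \<inter> Y) = Suc k"
    using candidate_card[OF cand certificateD(1)[OF cert]] crd by simp_all
  moreover have "(A \<union> {u, v}) \<inter> X = X" using closing(5) by blast
  ultimately have le: "l \<le> Suc k" if "l \<le> min (card X) (card Y)" for l using that by simp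
  have "f' (z g) = 0"
    using keep[OF g(3)] g(2) candidate_endpoints(3)[OF cand] by simp
  then have "line_cost L w X Y (gap g) (Suc k) = circle_cost L w X Y (Suc k)"
    using line_cost_eq_circle_cost[OF cert' crd'] by blast
  then have "line_cost L w X Y (gap g) l = circle_cost L w X Y l"
    if "l \<le> min (card X) (card Y)" for l
    using le[OF that] g(4) by (auto simp: le_Suc_eq)
  then show ?thesis
    using g(1) gaps_eq by auto
next
  case (remaining A \<rho> u v)
  then show ?thesis
    using greedy_state_inv[OF remaining(3)] gaps_eq unfolding greedy_inv_def by fastforce
qed

end

text \<open>The clauses on \<open>greedy_choice\<close> and on the existence of an output show that
  the construction never gets stuck, so the optimality of every output is not vacuous and yields the
  first clause.\<close>

theorem theorem4:
  fixes L w :: real and n m :: nat and x y :: "nat \<Rightarrow> real" and X Y :: "real set"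
  assumes "L > 0" and "w > 0" and "n \<ge> 1" and "m \<ge> 1"
    and "x ` {1..n} \<subseteq> {0..<L}" and "y ` {1..m} \<subseteq> {0..<L}"
    and "inj_on x {1..n}" and "inj_on y {1..m}"
    and "x ` {1..n} \<inter> y ` {1..m} = {}"
    and "X = x ` {1..n}" and "Y = y ` {1..m}"
  shows "(\<exists>G \<in> gaps L (X \<union> Y). \<forall>k \<le> min n m. line_cost L w X Y G k = circle_cost L w X Y k) \<and>
         (\<forall>k A \<rho>. greedy_state L w X Y k A \<rho> \<longrightarrow> k < min n m \<longrightarrow>
            (\<exists>u v. greedy_choice L w X Y A u v)) \<and>
         (\<exists>G. greedy_output L w X Y G) \<and>
         (\<forall>G. greedy_output L w X Y G \<longrightarrow>
            G \<in> gaps L (X \<union> Y) \<and>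
            (\<forall>k \<le> min n m. line_cost L w X Y G k = circle_cost L w X Y k))"
proof -
  interpret circle_atoms L w X Y
    by unfold_locales (use assms in auto)
  have crd: "card X = n" "card Y = m"
    using assms(7,8,10,11) by (simp_all add: card_image)
  have optimal: "G \<in> gaps L (X \<union> Y) \<and>
      (\<forall>k \<le> min n m. line_cost L w X Y G k = circle_cost L w X Y k)"
    if "greedy_output L w X Y G" for G
    using greedy_output_optimal[OF that] unfolding crd .
  moreover have "\<exists>u v. greedy_choice L w X Y A u v"
    if "greedy_state L w X Y k A \<rho>" "k < min n m" for k A \<rho>
    using greedy_choice_ex[OF greedy_state_inv[OF that(1)]] that(2) unfolding crd .
  ultimately show ?thesis
    using greedy_output_ex by blast
qed

end
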